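(* Suppose that $\kappa=\theta^+$ for a singular cardinal $\theta$. Then there exists a colouring $c:[\kappa]^2\to\theta$ witnessing $\mathrm{ubd}^{++}(J^+,J,\theta)$ for every subnormal $\kappa$-complete ideal $J$ over $\kappa$ extending $J^{\mathrm{bd}}[\kappa]$.
   Context: For an ideal $J$ over $\kappa$: $J^+$ positive sets, $J^*$ dual filter, $J^{\mathrm{bd}}[\kappa]$ bounded ideal. $J$ is subnormal if for every $\langle E_\eta\mid\eta<\kappa\rangle$ from $J^*$: (i) every $B\in J^+$ has $B'\subseteq B$ in $J^+$ with $\beta\in E_\eta$ for all $\eta<\beta$ in $B'$; (ii) for all $A,B\in J^+$ there are $A'\subseteq A$, $B'\subseteq B$ in $J^+$ with $\beta\in E_\eta$ for all $\eta\in A'$, $\beta\in B'$, $\eta<\beta$. Colourings are on pairs $\alpha<\beta<\kappa$; upper-regressive means $c(\alpha,\beta)<\beta$. For $\mathcal A\subseteq\mathcal P(\kappa)$, $\mathrm{ubd}^{++}(\mathcal A,J,\theta)$ asserts the existence of an upper-regressive $c:[\kappa]^2\to\theta$ such that for every $A\in\mathcal A$ and every sequence $\langle B_\tau\mid\tau<\theta\rangle$ of $J^+$-sets there are $\eta\in A$ and an injection $h:\theta\to\theta$ with $\{\beta\in B_\tau\setminus(\eta+1)\mid c(\eta,\beta)=h(\tau)\}\in J^+$ for every $\tau<\theta$. *)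

theory Defs
  imports Main
begin

unbundle cardinal_syntax

text \<open>
  A cardinal \<open>\<kappa>\<close> is represented by a well-ordered type \<open>'k\<close> whose order type is \<open>\<kappa>\<close>:
  the elements of \<open>'k\<close> play the role of the ordinals below \<open>\<kappa>\<close>, subsets of \<open>\<kappa>\<close> are values of
  type \<open>'k set\<close>, and an ordinal \<open>\<theta> < \<kappa>\<close> is an element of \<open>'k\<close>, identified, as in the von Neumann
  convention, with the set \<open>{..<\<theta>}\<close> of the smaller ordinals.
\<close>

definition ord_rel :: "'k::wellorder set \<Rightarrow> 'k rel" where
  "ord_rel S = {(\<alpha>, \<beta>). \<alpha> \<in> S \<and> \<beta> \<in> S \<and> \<alpha> \<le> \<beta>}"

lemma Field_ord_rel [simp]: "Field (ord_rel S) = S"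
  by (auto simp: ord_rel_def Field_def)

lemma Well_order_ord_rel: "Well_order (ord_rel S)"
proof -
  have "wf (ord_rel S - Id)"
    by (rule wf_subset[OF wf, where 'a1 = 'a]) (auto simp: ord_rel_def)
  then show ?thesis
    unfolding well_order_on_def linear_order_on_def partial_order_on_def preorder_on_def Field_ord_rel
    by (auto simp: ord_rel_def refl_on_def trans_def antisym_def total_on_def)
qed

definition singular_cardinal :: "'k::wellorder \<Rightarrow> bool" where
  "singular_cardinal \<theta> \<longleftrightarrow>
     Cinfinite (ord_rel {..<\<theta>}) \<and> \<not> regularCard (ord_rel {..<\<theta>})"

definition type_is_succ_of :: "'k::wellorder \<Rightarrow> bool" where
  "type_is_succ_of \<theta> \<longleftrightarrow> ord_rel (UNIV :: 'k set) =o cardSuc (ord_rel {..<\<theta>})"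

definition ideal_over :: "'k set set \<Rightarrow> bool" where
  "ideal_over J \<longleftrightarrow>
     {} \<in> J \<and> UNIV \<notin> J \<and>
     (\<forall>X\<in>J. \<forall>Y. Y \<subseteq> X \<longrightarrow> Y \<in> J) \<and>
     (\<forall>X\<in>J. \<forall>Y\<in>J. X \<union> Y \<in> J)"

definition positive :: "'k set set \<Rightarrow> 'k set set" where
  "positive J = {B. B \<notin> J}"

definition dual_filter :: "'k set set \<Rightarrow> 'k set set" where
  "dual_filter J = {E. - E \<in> J}"

definition bounded_ideal :: "'k::wellorder set set" where
  "bounded_ideal = {B. \<exists>\<gamma>. \<forall>\<beta>\<in>B. \<beta> < \<gamma>}"

definition kappa_complete :: "'k set set \<Rightarrow> bool" where
  "kappa_complete J \<longleftrightarrow>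
     (\<forall>F. F \<subseteq> J \<and> |F| <o |UNIV :: 'k set| \<longrightarrow> \<Union>F \<in> J)"

definition subnormal :: "'k::wellorder set set \<Rightarrow> bool" where
  "subnormal J \<longleftrightarrow>
     (\<forall>E :: 'k \<Rightarrow> 'k set. (\<forall>\<eta>. E \<eta> \<in> dual_filter J) \<longrightarrow>
       (\<forall>B\<in>positive J. \<exists>B'\<in>positive J. B' \<subseteq> B \<and>
          (\<forall>\<eta>\<in>B'. \<forall>\<beta>\<in>B'. \<eta> < \<beta> \<longrightarrow> \<beta> \<in> E \<eta>)) \<and>
       (\<forall>A\<in>positive J. \<forall>B\<in>positive J.
          \<exists>A'\<in>positive J. \<exists>B'\<in>positive J. A' \<subseteq> A \<and> B' \<subseteq> B \<and>
          (\<forall>\<eta>\<in>A'. \<forall>\<beta>\<in>B'. \<eta> < \<beta> \<longrightarrow> \<beta> \<in> E \<eta>)))"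

text \<open>
  A colouring of \<open>[\<kappa>]\<^sup>2\<close> is a curried function, of which only the values at pairs
  \<open>\<alpha> < \<beta>\<close> are relevant.
\<close>

definition colouring :: "'k::wellorder \<Rightarrow> ('k \<Rightarrow> 'k \<Rightarrow> 'k) \<Rightarrow> bool" where
  "colouring \<theta> c \<longleftrightarrow> (\<forall>\<alpha> \<beta>. \<alpha> < \<beta> \<longrightarrow> c \<alpha> \<beta> < \<theta>)"

definition upper_regressive :: "('k::wellorder \<Rightarrow> 'k \<Rightarrow> 'k) \<Rightarrow> bool" where
  "upper_regressive c \<longleftrightarrow> (\<forall>\<alpha> \<beta>. \<alpha> < \<beta> \<longrightarrow> c \<alpha> \<beta> < \<beta>)"

definition witnesses_ubd_pp ::
  "('k::wellorder \<Rightarrow> 'k \<Rightarrow> 'k) \<Rightarrow> 'k set set \<Rightarrow> 'k set set \<Rightarrow> 'k \<Rightarrow> bool" where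
  "witnesses_ubd_pp c \<A> J \<theta> \<longleftrightarrow>
     colouring \<theta> c \<and> upper_regressive c \<and>
     (\<forall>A\<in>\<A>. \<forall>B :: 'k \<Rightarrow> 'k set. (\<forall>\<tau><\<theta>. B \<tau> \<in> positive J) \<longrightarrow>
       (\<exists>\<eta>\<in>A. \<exists>h :: 'k \<Rightarrow> 'k. h ` {..<\<theta>} \<subseteq> {..<\<theta>} \<and> inj_on h {..<\<theta>} \<and>
         (\<forall>\<tau><\<theta>. {\<beta> \<in> B \<tau>. \<eta> < \<beta> \<and> c \<eta> \<beta> = h \<tau>} \<in> positive J)))"

end

theory Submission
  imports Defs
begin

text \<open>
  The colouring is \<open>c \<eta> \<beta> = f \<beta> (\<pi> (enum \<beta> \<eta>))\<close>, where \<open>enum \<beta>\<close> injects \<open>\<beta>\<close> into \<open>\<theta>\<close> and \<open>f\<close> is a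
  Shelah scale: a sequence of length \<open>\<theta>\<^sup>+\<close>, increasing modulo bounded sets, of functions on a cofinal
  set \<open>K\<close> of fewer than \<open>\<theta>\<close> coordinates, with an exact upper bound \<open>g\<close> such that \<open>cf (g a)\<close> tends
  to \<open>\<theta>\<close>. If the colours of a positive set of \<open>\<eta>\<close>'s were confined to sets \<open>D \<eta>\<close> of size at most
  \<open>m < \<theta>\<close>, take for each \<open>x \<in> K\<close> a set \<open>X x\<close> of \<open>x\<^sup>+\<close> many such \<open>\<eta>\<close>'s. The union of the
  corresponding \<open>D \<eta>\<close> is bounded below \<open>g i\<close> as soon as \<open>cf (g i) > x\<^sup>+\<close>, so one function
  \<open>d < g\<close> bounds all of them, and \<open>f \<beta>\<close> eventually exceeds \<open>d\<close> when \<open>\<beta>\<close> is large. Since \<open>X x\<close> has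
  more than \<open>x\<close> elements, some \<open>\<eta> \<in> X x\<close> has \<open>enum \<beta> \<eta> \<ge> x\<close>, which makes \<open>c \<eta> \<beta>\<close> escape \<open>D \<eta>\<close>.
  Subnormality and completeness reduce the theorem to this statement: for some \<open>\<eta> \<in> A\<close>, each \<open>B \<tau>\<close>
  attains \<open>\<theta>\<close> many colours positively, and then \<open>h\<close> is chosen greedily.

  The scale comes from the bounding projection property (\<open>interval_avoidance\<close>), which holds in ZFC
  for a sequence dominating itself along small clubs, by club guessing below \<open>\<theta>\<close>.
\<close>

section \<open>Cofinality and clubs in well-ordered types\<close>

text \<open>
  \<open>cof_gt \<delta> x\<close>: the cofinality of \<open>\<delta>\<close> exceeds \<open>|x|\<close> (for infinite \<open>x\<close>).
\<close>

definition cof_gt :: "'k::wellorder \<Rightarrow> 'k \<Rightarrow> bool" where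
  "cof_gt \<delta> x \<longleftrightarrow> (\<forall>Y\<subseteq>{..<\<delta>}. |Y| \<le>o |{..<x}| \<longrightarrow> (\<exists>z<\<delta>. \<forall>y\<in>Y. y < z))"

text \<open>The cardinal successor of |x| as an initial ordinal inside the type. It is an arbitrary
  element when no segment is larger than that of \<open>x\<close>, hence the hypothesis of
  \<open>csucc_props\<close>.\<close>

definition csucc :: "'k::wellorder \<Rightarrow> 'k" where
  "csucc x = (LEAST y. |{..<x}| <o |{..<y}| )"

section \<open>Cardinal arithmetic of initial segments\<close>

lemma seg_mono: "x \<le> (y::'k::wellorder) \<Longrightarrow> |{..<x}| \<le>o |{..<y}|"
  by (rule card_of_mono1) (simp add: lessThan_subset_iff)

lemma not_ordLess_card: "\<not> |A| <o |B| \<longleftrightarrow> |B| \<le>o |A|"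
  by (simp add: not_ordLess_iff_ordLeq card_of_Well_order)

lemma card_of_UN_le:
  assumes "infinite Z" "|I| \<le>o |Z|" "\<And>i. i \<in> I \<Longrightarrow> |A i| \<le>o |Z|"
  shows "|\<Union>i\<in>I. A i| \<le>o |Z|"
  using card_of_UNION_ordLeq_infinite[of Z I A] assms by auto

lemma card_of_Un_le:
  assumes "infinite Z" "|A| \<le>o |Z|" "|B| \<le>o |Z|"
  shows "|A \<union> B| \<le>o |Z|"
  by (rule card_of_Un_ordLeq_infinite_Field) (use assms in \<open>auto simp: Field_card_of card_of_card_order_on\<close>)

lemma card_of_finite_le:
  assumes "infinite Z" "finite A"
  shows "|A| \<le>o |Z|"
  by (rule ordLess_imp_ordLeq, rule finite_ordLess_infinite)
    (use assms in \<open>auto simp: Field_card_of card_of_well_order_on\<close>)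

lemma card_of_image_le: "|A| \<le>o |Z| \<Longrightarrow> |f ` A| \<le>o |Z|"
  using card_of_image ordLeq_transitive by blast

lemma card_of_subset_le: "|A| \<le>o |Z| \<Longrightarrow> B \<subseteq> A \<Longrightarrow> |B| \<le>o |Z|"
  using card_of_mono1 ordLeq_transitive by blast

lemma initial_segments_cover:
  fixes x :: "'k::wellorder" and Y :: "'k set"
  assumes "infinite {..<x}" "|Y| \<le>o |{..<x}|" "\<And>y. y \<in> Y \<Longrightarrow> |{..<y}| \<le>o |{..<x}|"
  shows "|\<Union>y\<in>Y. {..y}| \<le>o |{..<x}|"
proof (rule card_of_UN_le[OF assms(1,2)])
  fix y assume y: "y \<in> Y"
  have "{..y} = {..<y} \<union> {y}" by auto
  moreover have "|{..<y} \<union> {y}| \<le>o |{..<x}|"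
    by (rule card_of_Un_le[OF assms(1) assms(3)[OF y] card_of_finite_le[OF assms(1)]]) simp
  ultimately show "|{..y}| \<le>o |{..<x}|" by simp
qed

lemma csucc_props:
  fixes x y :: "'k::wellorder"
  assumes "|{..<x}| <o |{..<y}|"
  shows csucc_le: "csucc x \<le> y"
    and csucc_greater: "|{..<x}| <o |{..<csucc x}|"
    and below_csucc: "z < csucc x \<Longrightarrow> |{..<z}| \<le>o |{..<x}|"
    and less_csucc: "x < csucc x"
proof -
  show "csucc x \<le> y" unfolding csucc_def by (rule Least_le) (rule assms)
  show 1: "|{..<x}| <o |{..<csucc x}|" unfolding csucc_def by (rule LeastI) (rule assms)
  show "z < csucc x \<Longrightarrow> |{..<z}| \<le>o |{..<x}|"
    unfolding csucc_def using not_less_Least not_ordLess_card by blast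
  show "x < csucc x" using 1 seg_mono[of "csucc x" x] not_ordLess_card
    by (metis leI)
qed

text \<open>Successor cardinals are regular: every proper segment of \<open>csucc x\<close> has size
  at most |x|, so |x| of them cannot cover it.\<close>

lemma cof_gt_csucc:
  fixes x y :: "'k::wellorder"
  assumes "|{..<x}| <o |{..<y}|" "infinite {..<x}"
  shows "cof_gt (csucc x) x"
  unfolding cof_gt_def
proof (intro allI impI)
  fix Y assume Y: "Y \<subseteq> {..<csucc x}" "|Y| \<le>o |{..<x}|"
  have "|\<Union>y\<in>Y. {..y}| \<le>o |{..<x}|"
    using Y below_csucc[OF assms(1)] by (intro initial_segments_cover[OF assms(2)]) auto
  then have "\<not> {..<csucc x} \<subseteq> (\<Union>y\<in>Y. {..y})"
    using csucc_greater[OF assms(1)] card_of_subset_le[of "\<Union>y\<in>Y. {..y}" "{..<x}" "{..<csucc x}"]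
    unfolding not_ordLess_card[symmetric] by auto
  then show "\<exists>z<csucc x. \<forall>y\<in>Y. y < z" by (auto simp: not_le)
qed

lemma cof_gt_bounded:
  "cof_gt \<delta> x \<Longrightarrow> Y \<subseteq> {..<\<delta>} \<Longrightarrow> |Y| \<le>o |{..<x}| \<Longrightarrow> \<exists>z<\<delta>. \<forall>y\<in>Y. y < z"
  unfolding cof_gt_def by simp

lemma cof_gt_mono: "cof_gt \<delta> y \<Longrightarrow> x \<le> y \<Longrightarrow> cof_gt \<delta> x"
  unfolding cof_gt_def[of \<delta> x]
  by (intro allI impI) (rule cof_gt_bounded, assumption+, rule ordLeq_transitive[OF _ seg_mono])

lemma cof_gtD:
  assumes "cof_gt \<delta> x" "|I| \<le>o |{..<x}|" "\<And>i. i \<in> I \<Longrightarrow> u i < \<delta>"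
  shows "\<exists>z<\<delta>. \<forall>i\<in>I. u i < z"
proof -
  have "u ` I \<subseteq> {..<\<delta>}" "|u ` I| \<le>o |{..<x}|" using assms card_of_image_le by auto
  from cof_gt_bounded[OF assms(1) this] show ?thesis by auto
qed

lemma cof_gt_limit:
  assumes "cof_gt \<delta> x" "infinite {..<x}" "z < \<delta>"
  shows "\<exists>w<\<delta>. z < w"
  using cof_gtD[OF assms(1) card_of_finite_le[OF assms(2), of "{z}"], of "\<lambda>_. z"] assms(3) by simp

lemma cof_gt_image:
  fixes p :: "'k::wellorder \<Rightarrow> 'k"
  assumes \<rho>: "cof_gt \<rho> x"
    and mono: "\<And>i j. i < j \<Longrightarrow> j < \<rho> \<Longrightarrow> p i < p j"
    and less: "\<And>i. i < \<rho> \<Longrightarrow> p i < \<delta>"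
    and unb: "\<And>w. w < \<delta> \<Longrightarrow> \<exists>i<\<rho>. w < p i"
  shows "cof_gt \<delta> x"
  unfolding cof_gt_def
proof (intro allI impI)
  fix Y assume Y: "Y \<subseteq> {..<\<delta>}" "|Y| \<le>o |{..<x}|"
  obtain i where i: "\<And>w. w \<in> Y \<Longrightarrow> i w < \<rho> \<and> w < p (i w)"
    using unb Y by (metis lessThan_iff subsetD)
  obtain z where z: "z < \<rho>" "\<forall>w\<in>Y. i w < z"
    using cof_gtD[OF \<rho> Y(2), of i] i by blast
  then have "\<forall>y\<in>Y. y < p z" using i mono by (meson less_trans)
  then show "\<exists>z<\<delta>. \<forall>y\<in>Y. y < z" using less z by blast
qed

text \<open>
  In this form of closure the last clause is vacuous at the least element, which therefore belongs to
  every club; this makes \<open>last_le\<close> below total.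
\<close>

definition club :: "'k::wellorder \<Rightarrow> 'k set \<Rightarrow> bool" where
  "club \<delta> E \<longleftrightarrow> E \<subseteq> {..<\<delta>} \<and> (\<forall>z<\<delta>. \<exists>e\<in>E. z < e) \<and>
     (\<forall>z<\<delta>. (\<forall>w<z. \<exists>e\<in>E. w < e \<and> e \<le> z) \<longrightarrow> z \<in> E)"

lemma card_of_range_nat_le:
  fixes y :: "nat \<Rightarrow> 'k"
  assumes "infinite Z"
  shows "|range y| \<le>o |Z|"
  using assms by (metis infinite_iff_card_of_nat card_of_image_le)

text \<open>Unboundedness by interleaving: each step passes an element of every \<open>E i\<close>,
  and the supremum after \<omega> steps is a limit of each of them, hence a member. It stays below
  \<delta> because the cofinality of \<delta> is uncountable.\<close>

lemma club_Inter:
  fixes \<delta> x :: "'k::wellorder"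
  assumes \<delta>: "cof_gt \<delta> x" "infinite {..<x}"
    and I: "|I| \<le>o |{..<x}|"
    and E: "\<And>i. i \<in> I \<Longrightarrow> club \<delta> (E i)"
  shows "club \<delta> ({..<\<delta>} \<inter> (\<Inter>i\<in>I. E i))"
  unfolding club_def
proof (intro conjI allI impI)
  fix z assume z: "z < \<delta>"
  have "\<exists>y'<\<delta>. y < y' \<and> (\<forall>i\<in>I. \<exists>e\<in>E i. y < e \<and> e < y')" if y: "y < \<delta>" for y
  proof -
    have "\<forall>i\<in>I. \<exists>e. e \<in> E i \<and> y < e" using E y unfolding club_def by blast
    then obtain e where e: "\<And>i. i \<in> I \<Longrightarrow> e i \<in> E i \<and> y < e i" by metis
    obtain y1 where y1: "y1 < \<delta>" "\<forall>i\<in>I. e i < y1"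
      using cof_gtD[OF \<delta>(1) I, of e] e E unfolding club_def by blast
    obtain y2 where y2: "y2 < \<delta>" "max y y1 < y2"
      using cof_gt_limit[OF \<delta>, of "max y y1"] y y1 by auto
    with e y1 show ?thesis by (meson less_trans max_less_iff_conj)
  qed
  then obtain nx where nx: "\<And>y. y < \<delta> \<Longrightarrow> nx y < \<delta> \<and> y < nx y \<and> (\<forall>i\<in>I. \<exists>e\<in>E i. y < e \<and> e < nx y)"
    by metis
  define y where "y n = (nx ^^ n) z" for n
  have y\<delta>: "y n < \<delta>" for n by (induction n) (auto simp: y_def z nx)
  obtain b where b: "b < \<delta>" "\<forall>n. y n < b"
    using cof_gtD[OF \<delta>(1) card_of_range_nat_le[OF \<delta>(2)], of y id] y\<delta> by auto
  define u where "u = (LEAST u. \<forall>n. y n < u)"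
  have u: "y n < u" for n unfolding u_def using LeastI[of "\<lambda>u. \<forall>n. y n < u" b] b(2) by blast
  have u\<delta>: "u < \<delta>" unfolding u_def using Least_le[of "\<lambda>u. \<forall>n. y n < u" b] b by auto
  have wu: "\<exists>n. w \<le> y n" if "w < u" for w
    using not_less_Least[of w "\<lambda>u. \<forall>n. y n < u"] that unfolding u_def[symmetric]
    by (meson leI)
  have "u \<in> E i" if i: "i \<in> I" for i
  proof -
    have "\<exists>e\<in>E i. w < e \<and> e \<le> u" if w: "w < u" for w
    proof -
      obtain n where n: "w \<le> y n" using wu[OF w] by blast
      obtain e where "e \<in> E i" "y n < e" "e < y (Suc n)"
        using nx[OF y\<delta>, of n] i by (auto simp: y_def)
      then show ?thesis using n u[of "Suc n"] by (intro bexI[of _ e]) auto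
    qed
    then show ?thesis using E[OF i] u\<delta> unfolding club_def by blast
  qed
  moreover have "z < u" using u[of 0] by (simp add: y_def)
  ultimately show "\<exists>e\<in>{..<\<delta>} \<inter> (\<Inter>i\<in>I. E i). z < e" using u\<delta> by auto
next
  fix z assume z: "z < \<delta>" "\<forall>w<z. \<exists>e\<in>{..<\<delta>} \<inter> (\<Inter>i\<in>I. E i). w < e \<and> e \<le> z"
  have "z \<in> E i" if i: "i \<in> I" for i
  proof -
    have "\<forall>w<z. \<exists>e\<in>E i. w < e \<and> e \<le> z" using z(2) i by (meson IntD2 INT_D)
    then show ?thesis using E[OF i] z(1) unfolding club_def by blast
  qed
  then show "z \<in> {..<\<delta>} \<inter> (\<Inter>i\<in>I. E i)" using z by auto
qed auto

lemma club_Int: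
  assumes "cof_gt \<delta> x" "infinite {..<x}" "club \<delta> D" "club \<delta> E"
  shows "club \<delta> (D \<inter> E)"
proof -
  have "club \<delta> ({..<\<delta>} \<inter> (\<Inter>i\<in>{D,E}. i))"
    by (rule club_Inter[OF assms(1,2) card_of_finite_le[OF assms(2)]]) (use assms in auto)
  moreover have "D \<subseteq> {..<\<delta>}" using assms(3) unfolding club_def by simp
  then have "{..<\<delta>} \<inter> (\<Inter>i\<in>{D,E}. i) = D \<inter> E" by auto
  ultimately show ?thesis by simp
qed

text \<open>The supremum of the part of \<open>E\<close> up to \<gamma>, as a least upper bound so
  that it exists for any \<open>E\<close>; for a club, closure makes it a maximum.\<close>

definition last_le :: "'k::wellorder set \<Rightarrow> 'k \<Rightarrow> 'k" where
  "last_le E \<gamma> = (LEAST z. \<forall>e\<in>E. e \<le> \<gamma> \<longrightarrow> e \<le> z)"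

lemma last_le:
  assumes "club \<delta> E" "\<gamma> < \<delta>"
  shows last_le_le: "last_le E \<gamma> \<le> \<gamma>"
    and last_le_in: "last_le E \<gamma> \<in> E"
    and last_le_ge: "e \<in> E \<Longrightarrow> e \<le> \<gamma> \<Longrightarrow> e \<le> last_le E \<gamma>"
proof -
  show 1: "last_le E \<gamma> \<le> \<gamma>" unfolding last_le_def by (rule Least_le) auto
  have 2: "\<forall>e\<in>E. e \<le> \<gamma> \<longrightarrow> e \<le> last_le E \<gamma>" unfolding last_le_def by (rule LeastI[of _ \<gamma>]) auto
  then show "e \<in> E \<Longrightarrow> e \<le> \<gamma> \<Longrightarrow> e \<le> last_le E \<gamma>" by auto
  have "\<exists>e\<in>E. w < e \<and> e \<le> last_le E \<gamma>" if w: "w < last_le E \<gamma>" for w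
  proof -
    have "\<not> (\<forall>e\<in>E. e \<le> \<gamma> \<longrightarrow> e \<le> w)"
      using not_less_Least[OF w[unfolded last_le_def]] .
    then show ?thesis using 2 by (auto simp: not_le)
  qed
  moreover have "last_le E \<gamma> < \<delta>" using 1 assms(2) by simp
  ultimately show "last_le E \<gamma> \<in> E" using assms(1) unfolding club_def by simp
qed

text \<open>A weakly decreasing function into a well-order is eventually constant; the stages at
  which the |I| coordinates settle have a common bound below \<mu>.\<close>

lemma simultaneous_stabilization:
  fixes H :: "'k::wellorder \<Rightarrow> 'a \<Rightarrow> 'k"
  assumes \<mu>: "cof_gt \<mu> x" and I: "|I| \<le>o |{..<x}|"
    and anti: "\<And>i \<zeta> \<zeta>'. i \<in> I \<Longrightarrow> \<zeta> \<le> \<zeta>' \<Longrightarrow> \<zeta>' < \<mu> \<Longrightarrow> H \<zeta>' i \<le> H \<zeta> i"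
  shows "\<exists>\<zeta><\<mu>. \<forall>\<zeta>'. \<zeta> \<le> \<zeta>' \<longrightarrow> \<zeta>' < \<mu> \<longrightarrow> (\<forall>i\<in>I. H \<zeta>' i = H \<zeta> i)"
proof -
  have ne: "\<exists>z. z < \<mu>" using cof_gt_bounded[OF \<mu>, of "{}"] by (auto intro: card_of_empty)
  have "\<forall>i\<in>I. \<exists>\<zeta>. \<zeta> < \<mu> \<and> (\<forall>\<zeta>'<\<mu>. \<zeta> \<le> \<zeta>' \<longrightarrow> H \<zeta>' i = H \<zeta> i)"
  proof
    fix i assume i: "i \<in> I"
    define v where "v = (LEAST v. \<exists>\<zeta><\<mu>. v = H \<zeta> i)"
    have "\<exists>v. \<exists>\<zeta><\<mu>. v = H \<zeta> i" using ne by blast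
    from LeastI_ex[OF this] obtain \<zeta> where \<zeta>: "\<zeta> < \<mu>" "v = H \<zeta> i" unfolding v_def by blast
    have "H \<zeta>' i = H \<zeta> i" if "\<zeta>' < \<mu>" "\<zeta> \<le> \<zeta>'" for \<zeta>'
    proof (rule antisym)
      show "H \<zeta>' i \<le> H \<zeta> i" using anti[OF i] that by simp
      show "H \<zeta> i \<le> H \<zeta>' i" unfolding \<zeta>(2)[symmetric] v_def
        by (rule Least_le) (use that in auto)
    qed
    then show "\<exists>\<zeta>. \<zeta> < \<mu> \<and> (\<forall>\<zeta>'<\<mu>. \<zeta> \<le> \<zeta>' \<longrightarrow> H \<zeta>' i = H \<zeta> i)" using \<zeta>(1) by auto
  qed
  from bchoice[OF this] obtain Z
    where Z: "\<And>i. i \<in> I \<Longrightarrow> Z i < \<mu>"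
      and Z': "\<And>i \<zeta>'. i \<in> I \<Longrightarrow> \<zeta>' < \<mu> \<Longrightarrow> Z i \<le> \<zeta>' \<Longrightarrow> H \<zeta>' i = H (Z i) i" by auto
  obtain \<zeta> where \<zeta>: "\<zeta> < \<mu>" "\<forall>i\<in>I. Z i < \<zeta>" using cof_gtD[OF \<mu> I, of Z] Z by auto
  show ?thesis
  proof (intro exI conjI allI impI ballI)
    fix \<zeta>' i assume *: "\<zeta> \<le> \<zeta>'" "\<zeta>' < \<mu>" "i \<in> I"
    then have "Z i \<le> \<zeta>" "Z i \<le> \<zeta>'" using \<zeta> by auto
    then show "H \<zeta>' i = H \<zeta> i" using Z'[OF *(3), of \<zeta>'] Z'[OF *(3), of \<zeta>] *(2) \<zeta>(1) by metis
  qed (rule \<zeta>)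
qed

section \<open>Club guessing\<close>

lemma cof_gt_Least_bound:
  fixes p :: "'k::wellorder \<Rightarrow> 'k"
  assumes \<mu>: "cof_gt \<mu> x" and inf: "infinite {..<x}"
    and mono: "\<And>i j. i < j \<Longrightarrow> j < \<mu> \<Longrightarrow> p i < p j"
    and bound: "\<And>i. i < \<mu> \<Longrightarrow> p i < b"
  defines "\<delta> \<equiv> LEAST d. \<forall>i<\<mu>. p i < d"
  shows "\<delta> \<le> b" "\<And>i. i < \<mu> \<Longrightarrow> p i < \<delta>" "\<And>w. w < \<delta> \<Longrightarrow> \<exists>i<\<mu>. w < p i" "cof_gt \<delta> x"
proof -
  have P: "\<forall>i<\<mu>. p i < b" using bound by simp
  show "\<delta> \<le> b" unfolding \<delta>_def by (rule Least_le) (rule P)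
  have less: "\<forall>i<\<mu>. p i < \<delta>" unfolding \<delta>_def by (rule LeastI) (rule P)
  then show 1: "\<And>i. i < \<mu> \<Longrightarrow> p i < \<delta>" by simp
  show 2: "\<exists>i<\<mu>. w < p i" if w: "w < \<delta>" for w
  proof -
    have "\<not> (\<forall>i<\<mu>. p i < w)" using not_less_Least[OF w[unfolded \<delta>_def]] .
    then obtain i where i: "i < \<mu>" "w \<le> p i" by (auto simp: not_less)
    obtain j where "j < \<mu>" "i < j" using cof_gt_limit[OF \<mu> inf i(1)] by blast
    then show ?thesis using mono[of i j] i(2) by (intro exI[of _ j]) simp
  qed
  show "cof_gt \<delta> x" by (rule cof_gt_image[OF \<mu> mono 1 2])
qed

lemma club_subset: "club \<delta> E \<Longrightarrow> E \<subseteq> {..<\<delta>}"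
  unfolding club_def by simp

lemma club_unbounded: "club \<delta> E \<Longrightarrow> z < \<delta> \<Longrightarrow> \<exists>e\<in>E. z < e"
  unfolding club_def by simp

text \<open>
  Ladders are refined by a descending sequence of clubs, each defeating the guesses obtained from its
  predecessor; at a fixed \<open>\<delta>\<close> the refined ladders stabilize after fewer than \<open>\<mu>'\<close> steps.
\<close>

lemma club_guessing:
  fixes x \<mu> \<mu>' \<rho> :: "'k::wellorder"
  assumes inf: "infinite {..<x}" and le: "x \<le> \<mu>" "\<mu> \<le> \<mu>'"
    and \<mu>: "cof_gt \<mu> x" and \<mu>': "cof_gt \<mu>' \<mu>" and \<rho>: "cof_gt \<rho> \<mu>'"
  shows "\<exists>T C. T \<subseteq> {..<\<rho>} \<and> (\<forall>\<delta>\<in>T. \<not> |C \<delta>| \<le>o |{..<x}| ) \<and>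
           (\<forall>E. club \<rho> E \<longrightarrow> (\<exists>\<delta>\<in>T. C \<delta> \<subseteq> (E :: 'k set)))"
proof (rule ccontr)
  assume neg: "\<not> ?thesis"
  have inf\<mu>: "infinite {..<\<mu>}" and inf\<mu>': "infinite {..<\<mu>'}"
    using inf le by (meson finite_subset lessThan_subset_iff order_trans)+
  define cofinal where "cofinal \<delta> D \<longleftrightarrow> D \<subseteq> {..<\<delta>} \<and> |D| \<le>o |{..<\<mu>}| \<and> (\<forall>z<\<delta>. \<exists>e\<in>D. z < e)"
    for \<delta> :: 'k and D
  \<comment> \<open>The points whose cofinality lies above |x| and is at most |\<mu>|; each carries
    one fixed ladder \<open>D \<delta>\<close>.\<close>
  define S where "S = {\<delta>. \<delta> < \<rho> \<and> cof_gt \<delta> x \<and> Ex (cofinal \<delta>)}"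
  define D where "D \<delta> = (SOME D. cofinal \<delta> D)" for \<delta>
  have D: "cofinal \<delta> (D \<delta>)" if "\<delta> \<in> S" for \<delta>
    using that unfolding D_def S_def by (auto intro: someI_ex)
  define acc where "acc E \<delta> \<longleftrightarrow> (\<forall>z<\<delta>. \<exists>e\<in>E. z < e \<and> e < \<delta>)" for E and \<delta> :: 'k
  define proj where "proj E \<delta> = last_le E ` D \<delta>" for E \<delta>
  \<comment> \<open>\<open>proj E \<delta>\<close> pushes each rung down to \<open>E\<close>. It
    stays unbounded in \<delta> because \<open>E\<close> accumulates there, so the cofinality of
    \<delta> forces more than |x| values.\<close>
  have large: "\<not> |proj E \<delta>| \<le>o |{..<x}|" if E: "club \<rho> E" and \<delta>: "\<delta> \<in> S" "acc E \<delta>" for E \<delta>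
  proof
    assume small: "|proj E \<delta>| \<le>o |{..<x}|"
    have D\<delta>: "D \<delta> \<subseteq> {..<\<delta>}" "\<forall>z<\<delta>. \<exists>e\<in>D \<delta>. z < e" using D[OF \<delta>(1)] unfolding cofinal_def by auto
    have \<delta>': "\<delta> < \<rho>" "cof_gt \<delta> x" using \<delta>(1) unfolding S_def by auto
    have "proj E \<delta> \<subseteq> {..<\<delta>}"
      unfolding proj_def using last_le_le[OF E] D\<delta>(1) \<delta>'(1)
      by (auto intro!: le_less_trans[OF last_le_le[OF E]])
    from cof_gt_bounded[OF \<delta>'(2) this small]
    obtain z where z: "z < \<delta>" "\<forall>y\<in>proj E \<delta>. y < z" by blast
    obtain e where e: "e \<in> E" "z < e" "e < \<delta>" using \<delta>(2) z(1) unfolding acc_def by blast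
    obtain \<gamma> where \<gamma>: "\<gamma> \<in> D \<delta>" "e < \<gamma>" using D\<delta>(2) e(3) by blast
    have "e \<le> last_le E \<gamma>"
      using last_le_ge[OF E _ e(1)] \<gamma> D\<delta>(1) \<delta>'(1) by fastforce
    moreover have "last_le E \<gamma> < z" using z(2) \<gamma>(1) unfolding proj_def by blast
    ultimately show False using e(2) by simp
  qed
  \<comment> \<open>Otherwise the pushed-down ladders of \<open>E\<close> themselves form a guessing
    family, against \<open>neg\<close>.\<close>
  have "\<exists>E'. club \<rho> E' \<and> (\<forall>\<delta>\<in>S. acc E \<delta> \<longrightarrow> \<not> proj E \<delta> \<subseteq> E')" if E: "club \<rho> E" for E
  proof (rule ccontr)
    assume "\<not> ?thesis"
    then have "{\<delta>\<in>S. acc E \<delta>} \<subseteq> {..<\<rho>} \<and> (\<forall>\<delta>\<in>{\<delta>\<in>S. acc E \<delta>}. \<not> |proj E \<delta>| \<le>o |{..<x}| ) \<and>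
        (\<forall>E'. club \<rho> E' \<longrightarrow> (\<exists>\<delta>\<in>{\<delta>\<in>S. acc E \<delta>}. proj E \<delta> \<subseteq> E'))"
      using large[OF E] unfolding S_def by blast
    then show False using neg by blast
  qed
  then obtain F where F: "\<And>E. club \<rho> E \<Longrightarrow> club \<rho> (F E)"
    and F': "\<And>E \<delta>. club \<rho> E \<Longrightarrow> \<delta> \<in> S \<Longrightarrow> acc E \<delta> \<Longrightarrow> \<not> proj E \<delta> \<subseteq> F E"
    by metis
  have "\<exists>G. \<forall>\<zeta>::'k. G \<zeta> = {..<\<rho>} \<inter> (\<Inter>\<zeta>'\<in>{..<\<zeta>}. F (G \<zeta>'))"
    by (rule dependent_wellorder_choice) auto
  then obtain G :: "'k \<Rightarrow> 'k set" where "\<forall>\<zeta>. G \<zeta> = {..<\<rho>} \<inter> (\<Inter>\<zeta>'\<in>{..<\<zeta>}. F (G \<zeta>'))" ..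
  note G = this[rule_format]
  have clubG: "club \<rho> (G \<zeta>)" if "\<zeta> < \<mu>'" for \<zeta>
    using that
  proof (induction \<zeta> rule: less_induct)
    case (less \<zeta>)
    show ?case unfolding G[of \<zeta>]
      by (rule club_Inter[OF \<rho> inf\<mu>' seg_mono F]) (use less in auto)
  qed
  have antiG: "G \<zeta>' \<subseteq> G \<zeta>" if "\<zeta> \<le> \<zeta>'" for \<zeta> \<zeta>'
    unfolding G[of \<zeta>] G[of \<zeta>'] using that by (auto dest: less_le_trans)
  have GF: "G \<zeta>' \<subseteq> F (G \<zeta>)" if "\<zeta> < \<zeta>'" for \<zeta> \<zeta>'
    unfolding G[of \<zeta>'] using that by auto
  define E where "E = {..<\<rho>} \<inter> (\<Inter>\<zeta>\<in>{..<\<mu>'}. G \<zeta>)"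
  have clubE: "club \<rho> E" unfolding E_def
    by (rule club_Inter[OF \<rho> inf\<mu>' seg_mono clubG]) auto
  \<comment> \<open>An increasing \<mu>-sequence inside \<open>E\<close> has a supremum \<delta> in
    \<open>S\<close> at which every \<open>G \<zeta>\<close> with \<zeta> < \<open>\<mu>'\<close>
    accumulates.\<close>
  have "\<exists>p. \<forall>i. i < \<mu> \<longrightarrow> p i \<in> E \<and> (\<forall>j<i. p j < p i)"
  proof (rule dependent_wellorder_choice)
    fix i :: 'k and p :: "'k \<Rightarrow> 'k"
    assume IH: "\<And>y. y < i \<Longrightarrow> y < \<mu> \<longrightarrow> p y \<in> E \<and> (\<forall>j<y. p j < p y)"
    show "\<exists>r. i < \<mu> \<longrightarrow> r \<in> E \<and> (\<forall>j<i. p j < r)"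
    proof (cases "i < \<mu>")
      case True
      have "|{..<i}| \<le>o |{..<\<mu>'}|" by (rule seg_mono) (use True le in simp)
      moreover have "p j < \<rho>" if "j \<in> {..<i}" for j
        using IH[of j] that True club_subset[OF clubE] by auto
      ultimately obtain z where z: "z < \<rho>" "\<forall>j\<in>{..<i}. p j < z" using cof_gtD[OF \<rho>] by blast
      obtain e where "e \<in> E" "z < e" using club_unbounded[OF clubE z(1)] by blast
      then show ?thesis using z(2) by (intro exI[of _ e]) (auto dest: less_trans)
    qed simp
  qed auto
  then obtain p where pE: "\<And>i. i < \<mu> \<Longrightarrow> p i \<in> E" and pmono: "\<And>i j. i < j \<Longrightarrow> j < \<mu> \<Longrightarrow> p i < p j"
    by blast
  have p\<rho>: "p i < \<rho>" if "i \<in> {..<\<mu>}" for i using pE club_subset[OF clubE] that by auto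
  obtain b where b: "b < \<rho>" "\<forall>i\<in>{..<\<mu>}. p i < b" using cof_gtD[OF \<rho> seg_mono[OF le(2)], of p] p\<rho> by blast
  define \<delta> where "\<delta> = (LEAST d. \<forall>i<\<mu>. p i < d)"
  have \<delta>: "\<delta> \<le> b" "\<And>i. i < \<mu> \<Longrightarrow> p i < \<delta>" "\<And>w. w < \<delta> \<Longrightarrow> \<exists>i<\<mu>. w < p i" "cof_gt \<delta> x"
    unfolding \<delta>_def using cof_gt_Least_bound[OF \<mu> inf, of p b] pmono b(2) by auto
  have \<delta>\<rho>: "\<delta> < \<rho>" using \<delta>(1) b(1) by simp
  have "cofinal \<delta> (p ` {..<\<mu>})"
    unfolding cofinal_def using \<delta>(2,3) card_of_image by fastforce
  then have \<delta>S: "\<delta> \<in> S" unfolding S_def using \<delta>(4) \<delta>\<rho> by blast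
  have acc: "acc (G \<zeta>) \<delta>" if "\<zeta> < \<mu>'" for \<zeta>
    unfolding acc_def
  proof (intro allI impI)
    fix z assume "z < \<delta>"
    from \<delta>(3)[OF this] obtain i where i: "i < \<mu>" "z < p i" by blast
    then have "p i \<in> G \<zeta>" using pE[OF i(1)] that unfolding E_def by auto
    then show "\<exists>e\<in>G \<zeta>. z < e \<and> e < \<delta>" using \<delta>(2)[OF i(1)] i(2) by blast
  qed
  have D\<delta>: "|D \<delta>| \<le>o |{..<\<mu>}|" "\<And>\<gamma>. \<gamma> \<in> D \<delta> \<Longrightarrow> \<gamma> < \<rho>"
    using D[OF \<delta>S] \<delta>\<rho> unfolding cofinal_def by auto
  have anti: "last_le (G \<zeta>') \<gamma> \<le> last_le (G \<zeta>) \<gamma>" if "\<gamma> \<in> D \<delta>" "\<zeta> \<le> \<zeta>'" "\<zeta>' < \<mu>'" for \<gamma> \<zeta> \<zeta>'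
  proof -
    have "last_le (G \<zeta>') \<gamma> \<in> G \<zeta>'" "last_le (G \<zeta>') \<gamma> \<le> \<gamma>"
      using last_le_in[OF clubG[OF that(3)]] last_le_le[OF clubG[OF that(3)]] D\<delta>(2)[OF that(1)] by auto
    then show ?thesis
      using last_le_ge[OF clubG, of \<zeta> \<gamma>] that antiG[OF that(2)] D\<delta>(2)[OF that(1)] by auto
  qed
  have "\<exists>\<zeta><\<mu>'. \<forall>\<zeta>'. \<zeta> \<le> \<zeta>' \<longrightarrow> \<zeta>' < \<mu>' \<longrightarrow> (\<forall>\<gamma>\<in>D \<delta>. last_le (G \<zeta>') \<gamma> = last_le (G \<zeta>) \<gamma>)"
    by (rule simultaneous_stabilization[OF \<mu>' D\<delta>(1)]) (rule anti)
  then obtain \<zeta> where \<zeta>: "\<zeta> < \<mu>'"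
    "\<forall>\<zeta>'. \<zeta> \<le> \<zeta>' \<longrightarrow> \<zeta>' < \<mu>' \<longrightarrow> (\<forall>\<gamma>\<in>D \<delta>. last_le (G \<zeta>') \<gamma> = last_le (G \<zeta>) \<gamma>)"
    by (elim exE conjE)
  obtain \<zeta>' where \<zeta>': "\<zeta>' < \<mu>'" "\<zeta> < \<zeta>'" using cof_gt_limit[OF \<mu>' inf\<mu> \<zeta>(1)] by blast
  \<comment> \<open>Once stable, the ladder refined by \<open>G \<zeta>\<close> lies in the later
    club \<open>G \<zeta>'\<close>, hence in \<open>F (G \<zeta>)\<close>, which was chosen to
    defeat it.\<close>
  have "proj (G \<zeta>) \<delta> = proj (G \<zeta>') \<delta>"
    unfolding proj_def
    by (rule image_cong[OF refl]) (use \<zeta>(2)[rule_format, OF less_imp_le[OF \<zeta>'(2)] \<zeta>'(1)] in \<open>rule sym\<close>)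
  also have "\<dots> \<subseteq> G \<zeta>'"
    unfolding proj_def using last_le_in[OF clubG[OF \<zeta>'(1)]] D\<delta>(2) by auto
  also have "\<dots> \<subseteq> F (G \<zeta>)" by (rule GF[OF \<zeta>'(2)])
  finally show False using F'[OF clubG[OF \<zeta>(1)] \<delta>S acc[OF \<zeta>(1)]] by blast
qed

section \<open>Singular segments\<close>

text \<open>
  The coordinates of the functions below are the elements of \<open>K\<close>, a cofinal subset of \<open>\<theta>\<close> that need
  not be of minimal order type.
\<close>

locale singular_segment =
  fixes \<theta> :: "'k::wellorder" and K :: "'k set" and x\<^sub>0 :: 'k
  assumes seg_less: "\<And>x. x < \<theta> \<Longrightarrow> |{..<x}| <o |{..<\<theta>}|"
    and bounded: "\<And>Y :: 'k set. |Y| \<le>o |{..<\<theta>}| \<Longrightarrow> \<exists>z. \<forall>y\<in>Y. y < z"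
    and seg_le: "\<And>b :: 'k. |{..<b}| \<le>o |{..<\<theta>}|"
    and K_less: "\<And>a. a \<in> K \<Longrightarrow> a < \<theta>"
    and K_unbounded: "\<And>z. z < \<theta> \<Longrightarrow> \<exists>a\<in>K. z < a"
    and K_infinite: "\<And>a. a \<in> K \<Longrightarrow> infinite {..<a}"
    and x0_less: "x\<^sub>0 < \<theta>" and x0_infinite: "infinite {..<x\<^sub>0}" and K_card: "|K| \<le>o |{..<x\<^sub>0}|"

section \<open>From a singular cardinal and its successor to the working hypotheses\<close>

lemma seg_card_less:
  assumes "x < (\<theta>::'k::wellorder)"
  shows "ord_rel {..<x} <o ord_rel {..<\<theta>}"
proof -
  have "Restr (ord_rel {..<\<theta>}) (underS (ord_rel {..<\<theta>}) x) <o ord_rel {..<\<theta>}"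
    by (rule underS_Restr_ordLess[OF Well_order_ord_rel]) (use assms in \<open>simp add: ex_in_conv[symmetric], blast\<close>)
  moreover have "Restr (ord_rel {..<\<theta>}) (underS (ord_rel {..<\<theta>}) x) = ord_rel {..<x}"
    using assms by (fastforce simp: ord_rel_def underS_def)
  ultimately show ?thesis by simp
qed

lemma seg_card_le: "|{..<x}| \<le>o ord_rel {..<x}"
  using card_of_least[of "{..<x}" "ord_rel {..<x}"] Well_order_ord_rel[of "{..<x}"] by simp

lemma seg_representation:
  assumes "|X| <o ord_rel {..<(\<theta>::'k::wellorder)}"
  obtains m where "m < \<theta>" "|X| =o |{..<m}|"
proof -
  obtain m where m: "m \<in> {..<\<theta>}" "|X| =o Restr (ord_rel {..<\<theta>}) (underS (ord_rel {..<\<theta>}) m)"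
    using ordLess_iff_ordIso_Restr[OF Well_order_ord_rel card_of_Well_order, THEN iffD1, OF assms]
    unfolding Field_ord_rel by (elim bexE)
  moreover have "Restr (ord_rel {..<\<theta>}) (underS (ord_rel {..<\<theta>}) m) = ord_rel {..<m}"
    using m(1) by (fastforce simp: ord_rel_def underS_def)
  ultimately have "|X| =o |{..<m}|" using card_of_cong[of "|X|" "ord_rel {..<m}"] by (simp add: Field_card_of)
  then show ?thesis using that m(1) by simp
qed

text \<open>Failure of regularity gives a cofinal set smaller than \<theta>; dropping its elements
  up to an infinite segment makes every coordinate infinite. The bounds on segments and on subsets
  of size \<theta> come from \<kappa> being \<theta>^+.\<close>

lemma singular_segment_exists:
  fixes \<theta> :: "'k::wellorder"
  assumes sing: "singular_cardinal \<theta>" and succ: "type_is_succ_of \<theta>"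
  shows "\<exists>K x\<^sub>0. singular_segment \<theta> K x\<^sub>0"
proof -
  have card: "Card_order (ord_rel {..<\<theta>})" and inf: "infinite {..<\<theta>}"
    using sing unfolding singular_cardinal_def cinfinite_def by auto
  have iso: "|{..<\<theta>}| =o ord_rel {..<\<theta>}" using card_of_Field_ordIso[OF card] by simp
  have seg: "|{..<x}| <o |{..<\<theta>}|" if "x < \<theta>" for x
    using ordLeq_ordLess_trans[OF seg_card_le seg_card_less[OF that]] iso
    by (metis ordLess_ordIso_trans ordIso_symmetric)
  have segs: "|{..<x}| \<le>o |{..<\<theta>}|" for x :: 'k
  proof -
    have "|{..<x}| <o ord_rel (UNIV::'k set)"
    proof (rule ordLeq_ordLess_trans[OF seg_card_le])
      have "Restr (ord_rel UNIV) (underS (ord_rel UNIV) x) <o ord_rel (UNIV::'k set)"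
        by (rule underS_Restr_ordLess[OF Well_order_ord_rel]) auto
      moreover have "Restr (ord_rel UNIV) (underS (ord_rel UNIV) x) = ord_rel {..<x}"
        unfolding ord_rel_def underS_def by auto
      ultimately show "ord_rel {..<x} <o ord_rel (UNIV::'k set)" by simp
    qed
    then have "|{..<x}| <o cardSuc (ord_rel {..<\<theta>})"
      using succ ordLess_ordIso_trans unfolding type_is_succ_of_def by blast
    then have "|{..<x}| \<le>o ord_rel {..<\<theta>}"
      using cardSuc_ordLeq_ordLess[OF card card_of_Card_order] by blast
    then show ?thesis using iso ordIso_symmetric ordLeq_ordIso_trans by blast
  qed
  have UNIV: "\<not> |UNIV :: 'k set| \<le>o |{..<\<theta>}|"
  proof
    assume "|UNIV :: 'k set| \<le>o |{..<\<theta>}|"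
    moreover have "cardSuc (ord_rel {..<\<theta>}) \<le>o |UNIV :: 'k set|"
    proof -
      have "|UNIV :: 'k set| =o |Field (cardSuc (ord_rel {..<\<theta>}))|"
        using card_of_cong[OF succ[unfolded type_is_succ_of_def]] by simp
      moreover have "|Field (cardSuc (ord_rel {..<\<theta>}))| =o cardSuc (ord_rel {..<\<theta>})"
        by (rule card_of_Field_ordIso) (rule cardSuc_Card_order[OF card])
      ultimately show ?thesis by (meson ordIso_iff_ordLeq ordLeq_transitive)
    qed
    ultimately have "cardSuc (ord_rel {..<\<theta>}) \<le>o ord_rel {..<\<theta>}"
      using iso by (meson ordLeq_ordIso_trans ordLeq_transitive)
    then show False using cardSuc_greater[OF card] not_ordLess_ordLeq by blast
  qed
  have bounded: "\<exists>z. \<forall>y\<in>Y. y < z" if Y: "|Y| \<le>o |{..<\<theta>}|" for Y :: "'k set"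
  proof (rule ccontr)
    assume neg: "\<not> ?thesis"
    have "|\<Union>y\<in>Y. {..y}| \<le>o |{..<\<theta>}|"
      by (rule initial_segments_cover[OF inf Y]) (rule segs)
    moreover have "(\<Union>y\<in>Y. {..y}) = UNIV" using neg by (auto simp: not_less)
    ultimately show False using UNIV by simp
  qed
  obtain K where K: "K \<subseteq> {..<\<theta>}" "cofinal K (ord_rel {..<\<theta>})" "\<not> |K| =o ord_rel {..<\<theta>}"
    using sing unfolding singular_cardinal_def regularCard_def by auto
  have "|K| \<le>o |{..<\<theta>}|" using K(1) by (rule card_of_mono1)
  then have "|K| <o ord_rel {..<\<theta>}"
    using K(3) iso by (meson ordLeq_iff_ordLess_or_ordIso ordLeq_ordIso_trans)
  then obtain m where m: "m < \<theta>" "|K| =o |{..<m}|" by (rule seg_representation)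
  have K_unb: "\<exists>a\<in>K. z < a" if z: "z < \<theta>" for z
  proof -
    obtain b where "b \<in> K" "z \<noteq> b" "(z, b) \<in> ord_rel {..<\<theta>}"
      using K(2) z unfolding cofinal_def Field_ord_rel by blast
    then show ?thesis by (intro bexI[of _ b]) (auto simp: ord_rel_def)
  qed
  \<comment> \<open>A singular cardinal is uncountable: if \<theta> were countable, its proper
    segments and \<open>K\<close> would be finite, and so would \<theta>.\<close>
  have "|UNIV :: nat set| <o ord_rel {..<\<theta>}"
  proof (rule ccontr)
    assume "\<not> ?thesis"
    then have le: "|{..<\<theta>}| \<le>o |UNIV :: nat set|"
      using iso by (meson card_of_Well_order not_ordLess_iff_ordLeq Well_order_ord_rel ordIso_ordLeq_trans)
    have "finite {..<a}" if "a < \<theta>" for a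
      using seg[OF that] le finite_iff_ordLess_natLeq card_of_nat
      by (meson ordLess_ordIso_trans ordLess_ordLeq_trans)
    then have "finite {..a}" if "a < \<theta>" for a
      using that by (simp add: ivl_disj_un_singleton(2)[symmetric])
    moreover have "finite K"
      using m \<open>\<And>a. a < \<theta> \<Longrightarrow> finite {..<a}\<close> card_of_ordIso_finite by blast
    ultimately have "finite (\<Union>a\<in>K. {..a})" using K(1) by auto
    moreover have "{..<\<theta>} \<subseteq> (\<Union>a\<in>K. {..a})" by (auto dest!: K_unb intro: less_imp_le)
    ultimately show False using inf finite_subset by blast
  qed
  then obtain w where w: "w < \<theta>" "|UNIV :: nat set| =o |{..<w}|" by (rule seg_representation)
  then have "infinite {..<w}" using card_of_ordIso_finite infinite_UNIV_nat by blast
  then have inf_ge: "infinite {..<a}" if "w \<le> a" for a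
    using that by (meson finite_subset lessThan_subset_iff)
  define x where "x = max m w"
  have x: "x < \<theta>" "m \<le> x" "w \<le> x" unfolding x_def using m w by auto
  have "singular_segment \<theta> {a\<in>K. w < a} x"
  proof
    show "\<And>z. z < \<theta> \<Longrightarrow> \<exists>a\<in>{a\<in>K. w < a}. z < a"
      using K_unb[of "max _ w"] w(1) by auto
    show "|{a\<in>K. w < a}| \<le>o |{..<x}|"
    proof (rule card_of_subset_le)
      show "|K| \<le>o |{..<x}|" using m(2) seg_mono[OF x(2)] by (rule ordIso_ordLeq_trans)
    qed auto
  qed (use seg segs bounded K(1) x inf_ge in auto)
  then show ?thesis by blast
qed

context singular_segment
begin

text \<open>A singular cardinal is a limit cardinal: if every segment below \<theta> had size at
  most |x|, the few segments ending in \<open>K\<close> would cover \<theta> with at most |x|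
  points.\<close>

lemma seg_less_succ:
  assumes "x < \<theta>"
  shows "\<exists>y<\<theta>. |{..<x}| <o |{..<y}|"
proof (rule ccontr)
  assume "\<not> ?thesis"
  then have *: "|{..<y}| \<le>o |{..<x}|" if "y < \<theta>" for y using that not_ordLess_card by blast
  have inf: "infinite {..<x}"
    using *[OF x0_less] x0_infinite card_of_ordLeq_finite by blast
  have "|\<Union>a\<in>K. {..a}| \<le>o |{..<x}|"
    by (rule initial_segments_cover[OF inf ordLeq_transitive[OF K_card *[OF x0_less]] *[OF K_less]])
  moreover have "{..<\<theta>} \<subseteq> (\<Union>a\<in>K. {..a})" by (auto dest!: K_unbounded intro: less_imp_le)
  ultimately have "|{..<\<theta>}| \<le>o |{..<x}|" by (rule card_of_subset_le)
  then show False using seg_less[OF assms] not_ordLess_card by blast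
qed

lemma csucc_facts:
  assumes "x < \<theta>"
  shows csucc_less: "csucc x < \<theta>"
    and seg_csucc: "|{..<x}| <o |{..<csucc x}|"
    and seg_below_csucc: "z < csucc x \<Longrightarrow> |{..<z}| \<le>o |{..<x}|"
    and le_csucc: "x \<le> csucc x"
    and cof_gt_csucc': "infinite {..<x} \<Longrightarrow> cof_gt (csucc x) x"
proof -
  obtain y where y: "y < \<theta>" "|{..<x}| <o |{..<y}|" using seg_less_succ[OF assms] by blast
  show "csucc x < \<theta>" using csucc_le[OF y(2)] y(1) by simp
  show "|{..<x}| <o |{..<csucc x}|" by (rule csucc_greater[OF y(2)])
  show "z < csucc x \<Longrightarrow> |{..<z}| \<le>o |{..<x}|" by (rule below_csucc[OF y(2)])
  show "x \<le> csucc x" using less_csucc[OF y(2)] by simp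
  show "infinite {..<x} \<Longrightarrow> cof_gt (csucc x) x" by (rule cof_gt_csucc[OF y(2)])
qed

lemma theta_infinite: "infinite {..<\<theta>}"
  using x0_infinite x0_less by (meson finite_subset lessThan_subset_iff less_imp_le)

lemma infinite_above: "infinite {..<x} \<Longrightarrow> x \<le> y \<Longrightarrow> infinite {..<y::'k}"
  by (meson finite_subset lessThan_subset_iff)

lemma bounded_family:
  assumes "|I| \<le>o |{..<\<theta>}|"
  shows "\<exists>z::'k. \<forall>i\<in>I. u i < z"
  using bounded[of "u ` I"] card_of_image_le[OF assms, of u] by auto

lemma no_max: "\<exists>z. (y::'k) < z"
  using bounded_family[OF card_of_finite_le[OF theta_infinite, of "{y}"], of "\<lambda>y. y"] by auto

lemma card_less_segment:
  assumes "|X| <o |{..<\<theta>}|"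
  shows "\<exists>m<\<theta>. |X| \<le>o |{..<m}|"
proof (rule ccontr)
  assume neg: "\<not> ?thesis"
  then have *: "|{..<m}| \<le>o |X|" if "m < \<theta>" for m
    using that not_ordLess_card ordLess_imp_ordLeq by blast
  have inf: "infinite X" using *[OF x0_less] x0_infinite card_of_ordLeq_finite by blast
  have "|\<Union>a\<in>K. {..<a}| \<le>o |X|"
    by (rule card_of_UN_le[OF inf ordLeq_transitive[OF K_card *[OF x0_less]] *[OF K_less]])
  moreover have "{..<\<theta>} \<subseteq> (\<Union>a\<in>K. {..<a})" by (auto dest!: K_unbounded)
  ultimately have "|{..<\<theta>}| \<le>o |X|" by (rule card_of_subset_le)
  then show False using assms not_ordLess_card by blast
qed

text \<open>The filter generated by the end segments of \<open>K\<close>: relations modulo bounded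
  sets become \<open>eventually\<close> statements.\<close>

definition coordinates :: "'k filter" where
  "coordinates = (INF n\<in>{..<\<theta>}. principal {a\<in>K. n \<le> a})"

lemma eventually_coordinates:
  "eventually P coordinates \<longleftrightarrow> (\<exists>n<\<theta>. \<forall>a\<in>K. n \<le> a \<longrightarrow> P a)"
proof -
  have "eventually P coordinates \<longleftrightarrow> (\<exists>n\<in>{..<\<theta>}. eventually P (principal {a\<in>K. n \<le> a}))"
    unfolding coordinates_def
  proof (rule eventually_INF_base)
    show "{..<\<theta>} \<noteq> {}" using x0_less by auto
    fix a b assume "a \<in> {..<\<theta>}" "b \<in> {..<\<theta>}"
    then show "\<exists>x\<in>{..<\<theta>}. principal {a\<in>K. x \<le> a} \<le>
        inf (principal {c\<in>K. a \<le> c}) (principal {a\<in>K. b \<le> a})"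
      by (intro bexI[of _ "max a b"]) auto
  qed
  then show ?thesis by (auto simp: eventually_principal)
qed

lemma eventually_K: "eventually (\<lambda>a. a \<in> K) coordinates"
  unfolding eventually_coordinates using x0_less by blast

end

section \<open>A sequence with the bounding projection property\<close>

context singular_segment
begin

definition enum :: "'k \<Rightarrow> 'k \<Rightarrow> 'k" where
  "enum \<beta> = (SOME e. inj_on e {..<\<beta>} \<and> e ` {..<\<beta>} \<subseteq> {..<\<theta>})"

lemma enum: "inj_on (enum \<beta>) {..<\<beta>}" "\<eta> < \<beta> \<Longrightarrow> enum \<beta> \<eta> < \<theta>"
proof -
  have "\<exists>e. inj_on e {..<\<beta>} \<and> e ` {..<\<beta>} \<subseteq> {..<\<theta>}"
    unfolding card_of_ordLeq by (rule seg_le)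
  from someI_ex[OF this] show "inj_on (enum \<beta>) {..<\<beta>}" "\<eta> < \<beta> \<Longrightarrow> enum \<beta> \<eta> < \<theta>"
    unfolding enum_def by auto
qed

text \<open>Serves twice: it keeps the sets over which the sequence is built small, and it shows
  that more than |a| many \<eta> cannot all have \<open>enum \<beta>\<close> values below
  \<open>a\<close>.\<close>

lemma card_enum_less: "|{\<eta>\<in>{..<\<beta>}. enum \<beta> \<eta> < a}| \<le>o |{..<a}|"
  by (rule card_of_ordLeqI[of "enum \<beta>"]) (auto intro: inj_on_subset[OF enum(1)])

text \<open>Recursion on the index: \<open>f \<alpha> a\<close> is the least strict bound of
  \<open>f \<eta> a\<close> over a set of at most |a| earlier \<eta>. Regularity of
  \<open>csucc a\<close> keeps the values below it, and these sets grow with \<open>a\<close> to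
  absorb each \<eta> below \<alpha> and a small club, if there is one.\<close>

lemma exists_dominating_sequence:
  "\<exists>f :: 'k \<Rightarrow> 'k \<Rightarrow> 'k. (\<forall>\<alpha>. \<forall>a\<in>K. f \<alpha> a < \<theta>) \<and>
     (\<forall>\<alpha> \<beta>. \<alpha> < \<beta> \<longrightarrow> eventually (\<lambda>a. f \<alpha> a < f \<beta> a) coordinates) \<and>
     (\<forall>\<delta> R. club \<delta> R \<longrightarrow> |R| <o |{..<\<theta>}| \<longrightarrow>
        (\<exists>E. club \<delta> E \<and> eventually (\<lambda>a. \<forall>\<eta>\<in>E. f \<eta> a < f \<delta> a) coordinates))"
proof -
  define small_club where "small_club \<delta> E \<longleftrightarrow> club \<delta> E \<and> |E| <o |{..<\<theta>}|" for \<delta> and E :: "'k set"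
  define ladder where "ladder \<delta> = (SOME E. small_club \<delta> E)" for \<delta>
  define earlier where "earlier a \<alpha> = {\<eta>\<in>{..<\<alpha>}. enum \<alpha> \<eta> < a} \<union>
      (if small_club \<alpha> (ladder \<alpha>) \<and> |ladder \<alpha>| \<le>o |{..<a}| then ladder \<alpha> else {})" for a \<alpha>
  have card_earlier: "|earlier a \<alpha>| \<le>o |{..<a}|" if "a \<in> K" for a \<alpha>
    unfolding earlier_def
    by (rule card_of_Un_le[OF K_infinite[OF that] card_enum_less])
      (auto intro: card_of_empty)
  have earlier_less: "\<eta> < \<alpha>" if "\<eta> \<in> earlier a \<alpha>" for \<eta> a \<alpha>
    using that club_subset[of \<alpha> "ladder \<alpha>"] unfolding earlier_def small_club_def
    by (auto split: if_splits)
  have "\<exists>f. \<forall>\<alpha>. f \<alpha> = (\<lambda>a. LEAST y::'k. \<forall>\<eta>\<in>earlier a \<alpha>. f \<eta> a < y)"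
  proof (rule dependent_wellorder_choice)
    fix r :: "'k \<Rightarrow> 'k" and f g :: "'k \<Rightarrow> 'k \<Rightarrow> 'k" and \<alpha> :: 'k
    assume *: "\<And>y. y < \<alpha> \<Longrightarrow> f y = g y"
    have "(\<forall>\<eta>\<in>earlier a \<alpha>. f \<eta> a < y) \<longleftrightarrow> (\<forall>\<eta>\<in>earlier a \<alpha>. g \<eta> a < y)" for a y
      by (rule ball_cong[OF refl]) (simp add: *[OF earlier_less])
    then show "(r = (\<lambda>a. LEAST y. \<forall>\<eta>\<in>earlier a \<alpha>. f \<eta> a < y)) =
        (r = (\<lambda>a. LEAST y. \<forall>\<eta>\<in>earlier a \<alpha>. g \<eta> a < y))" by simp
  qed auto
  then obtain f :: "'k \<Rightarrow> 'k \<Rightarrow> 'k" where f_eq: "\<forall>\<alpha>. f \<alpha> = (\<lambda>a. LEAST y. \<forall>\<eta>\<in>earlier a \<alpha>. f \<eta> a < y)" ..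
  have f: "f \<alpha> a = (LEAST y. \<forall>\<eta>\<in>earlier a \<alpha>. f \<eta> a < y)" for \<alpha> a
    by (rule fun_cong[OF spec[OF f_eq]])
  have f_less: "f \<alpha> a < csucc a" if a: "a \<in> K" for \<alpha> a
  proof (induction \<alpha> rule: less_induct)
    case (less \<alpha>)
    have "cof_gt (csucc a) a" by (rule cof_gt_csucc'[OF K_less[OF a] K_infinite[OF a]])
    from cof_gtD[OF this card_earlier[OF a], of \<alpha> "\<lambda>\<eta>. f \<eta> a"] less earlier_less
    obtain z where z: "z < csucc a" "\<forall>\<eta>\<in>earlier a \<alpha>. f \<eta> a < z" by blast
    show ?case unfolding f[of \<alpha>]
      by (rule le_less_trans[OF Least_le[of "\<lambda>y. \<forall>\<eta>\<in>earlier a \<alpha>. f \<eta> a < y", OF z(2)] z(1)])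
  qed
  have f_gt: "f \<eta> a < f \<alpha> a" if "\<eta> \<in> earlier a \<alpha>" "a \<in> K" for \<eta> a \<alpha>
  proof -
    have "\<forall>\<eta>\<in>earlier a \<alpha>. f \<eta> a < csucc a" using f_less[OF that(2)] by blast
    then have "\<forall>\<eta>\<in>earlier a \<alpha>. f \<eta> a < f \<alpha> a" unfolding f[of \<alpha>] by (rule LeastI)
    then show ?thesis using that(1) by blast
  qed
  show ?thesis
  proof (intro exI[of _ f] conjI allI impI ballI)
    fix \<alpha> a assume "a \<in> K"
    then show "f \<alpha> a < \<theta>" using f_less csucc_less[OF K_less] by (meson less_trans)
  next
    fix \<alpha> \<beta> :: 'k assume "\<alpha> < \<beta>"
    then have "\<alpha> \<in> earlier a \<beta>" if "enum \<beta> \<alpha> < a" for a using that unfolding earlier_def by auto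
    moreover obtain n where "n < \<theta>" "enum \<beta> \<alpha> < n"
      using K_unbounded[OF enum(2)[OF \<open>\<alpha> < \<beta>\<close>]] K_less by blast
    ultimately show "eventually (\<lambda>a. f \<alpha> a < f \<beta> a) coordinates"
      unfolding eventually_coordinates using f_gt by (meson less_le_trans)
  next
    \<comment> \<open>The club \<open>R\<close> certifies that a small club exists; domination holds
      along the chosen \<open>ladder \<delta>\<close>.\<close>
    fix \<delta> and R :: "'k set" assume "club \<delta> R" "|R| <o |{..<\<theta>}|"
    then have "\<exists>E. small_club \<delta> E" unfolding small_club_def by blast
    then have sc: "small_club \<delta> (ladder \<delta>)" unfolding ladder_def by (rule someI_ex)
    then obtain m where m: "m < \<theta>" "|ladder \<delta>| \<le>o |{..<m}|" using card_less_segment unfolding small_club_def by blast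
    have "ladder \<delta> \<subseteq> earlier a \<delta>" if "m \<le> a" for a
      using sc ordLeq_transitive[OF m(2) seg_mono[OF that]] unfolding earlier_def by simp
    then have "eventually (\<lambda>a. \<forall>\<eta>\<in>ladder \<delta>. f \<eta> a < f \<delta> a) coordinates"
      unfolding eventually_coordinates using f_gt m(1) by blast
    then show "\<exists>E. club \<delta> E \<and> eventually (\<lambda>a. \<forall>\<eta>\<in>E. f \<eta> a < f \<delta> a) coordinates"
      using sc unfolding small_club_def by blast
  qed
qed

end

text \<open>In \<open>f_club\<close> the quantifier over \<eta> stands inside
  \<open>eventually\<close>: one bound on the coordinates serves the whole club, which
  \<open>f_mono\<close> alone does not give.\<close>

locale dominating_sequence = singular_segment \<theta> K x\<^sub>0
  for \<theta> :: "'k::wellorder" and K x\<^sub>0 +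
  fixes f :: "'k \<Rightarrow> 'k \<Rightarrow> 'k"
  assumes f_less: "\<And>\<alpha> a. a \<in> K \<Longrightarrow> f \<alpha> a < \<theta>"
    and f_mono: "\<And>\<alpha> \<beta>. \<alpha> < \<beta> \<Longrightarrow> eventually (\<lambda>a. f \<alpha> a < f \<beta> a) coordinates"
    and f_club: "\<And>\<delta> R. club \<delta> R \<Longrightarrow> |R| <o |{..<\<theta>}| \<Longrightarrow>
        \<exists>E. club \<delta> E \<and> eventually (\<lambda>a. \<forall>\<eta>\<in>E. f \<eta> a < f \<delta> a) coordinates"
begin

text \<open>
  The bounding projection property. If it fails, build a continuous \<open>\<xi> : \<rho> \<rightarrow> \<kappa>\<close> along which the
  failure recurs and which outgrows every dominated set \<open>\<xi> [C t \<inter> {..i}]\<close>. A guess \<open>C t\<close> inside the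
  club of \<open>i\<close> with \<open>\<xi> i \<in> E\<close> gives points \<open>s\<close> that strictly increase on each coordinate, hence an
  injection of almost all of \<open>C t\<close> into the disjoint sum of the sets \<open>S a\<close>.
\<close>

lemma interval_avoidance:
  assumes x: "x < \<theta>" "infinite {..<x}" and Kx: "|K| \<le>o |{..<x}|"
    and S: "\<And>a. a \<in> K \<Longrightarrow> |S a| \<le>o |{..<x}|"
  shows "\<exists>\<alpha>. \<forall>\<beta>>\<alpha>. eventually (\<lambda>a. \<not> (\<exists>s\<in>S a. f \<alpha> a \<le> s \<and> s < f \<beta> a)) coordinates"
proof (rule ccontr)
  assume neg: "\<not> ?thesis"
  have "\<forall>\<alpha>. \<exists>\<beta>. frequently (\<lambda>a. \<exists>s\<in>S a. f \<alpha> a \<le> s \<and> s < f \<beta> a) coordinates"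
    unfolding frequently_def using neg by blast
  from choice[OF this] obtain nb
    where nb: "\<And>\<alpha>. frequently (\<lambda>a. \<exists>s\<in>S a. f \<alpha> a \<le> s \<and> s < f (nb \<alpha>) a) coordinates" by blast
  define \<mu> \<mu>' where "\<mu> = csucc x" and "\<mu>' = csucc \<mu>"
  define \<rho> where "\<rho> = csucc \<mu>'"
  have \<mu>: "\<mu> < \<theta>" "x \<le> \<mu>" "cof_gt \<mu> x" "infinite {..<\<mu>}"
    unfolding \<mu>_def
    using csucc_less le_csucc cof_gt_csucc' infinite_above[OF x(2) le_csucc] x by blast+
  have \<mu>': "\<mu>' < \<theta>" "\<mu> \<le> \<mu>'" "cof_gt \<mu>' \<mu>" "infinite {..<\<mu>'}"
    unfolding \<mu>'_def
    using csucc_less le_csucc cof_gt_csucc' infinite_above[OF \<mu>(4) le_csucc] \<mu>(1,4) by blast+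
  have \<rho>: "\<rho> < \<theta>" "cof_gt \<rho> \<mu>'"
    unfolding \<rho>_def using csucc_less cof_gt_csucc' \<mu>'(1,4) by blast+
  obtain T C where T: "T \<subseteq> {..<\<rho>}" and large: "\<And>t. t \<in> T \<Longrightarrow> \<not> |C t| \<le>o |{..<x}|"
    and guess: "\<And>E. club \<rho> E \<Longrightarrow> \<exists>t\<in>T. C t \<subseteq> E"
    using club_guessing[OF x(2) \<mu>(2) \<mu>'(2) \<mu>(3) \<mu>'(3) \<rho>(2)] by blast
  have cardT: "|T| \<le>o |{..<\<theta>}|"
    using T \<rho>(1) by (intro card_of_mono1) auto
  define dom where "dom \<sigma> X \<longleftrightarrow> eventually (\<lambda>a. \<forall>\<eta>\<in>X. f \<eta> a < f \<sigma> a) coordinates" for \<sigma> X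
  \<comment> \<open>\<open>\<sigma> X\<close> uniformly dominates \<open>X\<close> if anything does,
    and is arbitrary otherwise. \<open>\<tau> \<xi> i\<close> exceeds these choices for all guesses
    cut at \<open>i\<close>, and \<open>bnd\<close> adds the index at which avoidance fails above
    \<open>\<tau> \<xi> i\<close>.\<close>
  define \<sigma> where "\<sigma> X = (SOME \<sigma>. dom \<sigma> X)" for X
  define \<tau> where "\<tau> \<xi> i = (SOME z::'k. \<forall>t\<in>T. \<sigma> (\<xi> ` (C t \<inter> {..i})) < z)" for \<xi> i
  define bnd where "bnd \<xi> i = max (nb (\<tau> \<xi> i)) (\<xi> i)" for \<xi> i
  have \<tau>: "\<sigma> (\<xi> ` (C t \<inter> {..i})) < \<tau> \<xi> i" if "t \<in> T" for \<xi> i t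
    using someI_ex[OF bounded_family[OF cardT, of "\<lambda>t. \<sigma> (\<xi> ` (C t \<inter> {..i}))"]] that unfolding \<tau>_def by blast
  \<comment> \<open>Least strict bounds make \<xi> increasing and continuous, so its values below
    \<rho> form a small club in \<open>\<xi> \<rho>\<close>, where \<open>f_club\<close>
    applies.\<close>
  have "\<exists>\<xi>::'k \<Rightarrow> 'k. \<forall>i. \<xi> i = (LEAST y. \<forall>j<i. bnd \<xi> j < y)"
  proof (rule dependent_wellorder_choice)
    fix r i :: 'k and \<xi> \<xi>' :: "'k \<Rightarrow> 'k"
    assume *: "\<And>y. y < i \<Longrightarrow> \<xi> y = \<xi>' y"
    have "bnd \<xi> j = bnd \<xi>' j" if "j < i" for j
    proof -
      have "\<xi> ` (C t \<inter> {..j}) = \<xi>' ` (C t \<inter> {..j})" for t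
        by (rule image_cong[OF refl]) (use that * in auto)
      then show ?thesis unfolding bnd_def \<tau>_def using *[OF that] by simp
    qed
    then show "(r = (LEAST y. \<forall>j<i. bnd \<xi> j < y)) = (r = (LEAST y. \<forall>j<i. bnd \<xi>' j < y))"
      by (simp cong: imp_cong)
  qed auto
  then obtain \<xi> :: "'k \<Rightarrow> 'k" where \<xi>: "\<forall>i. \<xi> i = (LEAST y. \<forall>j<i. bnd \<xi> j < y)" ..
  define b where "b i = bnd \<xi> i" for i
  have b\<xi>: "b j < \<xi> i" if "j < i" for i j
  proof -
    have "\<exists>y. \<forall>j<i. bnd \<xi> j < y" using bounded_family[OF seg_le, of i "bnd \<xi>"] by auto
    then have "\<forall>j<i. bnd \<xi> j < \<xi> i" unfolding spec[OF \<xi>, of i] by (rule LeastI_ex)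
    then show ?thesis using that unfolding b_def by blast
  qed
  have \<xi>b: "\<exists>j<i. w \<le> b j" if w: "w < \<xi> i" for i w
    using not_less_Least[OF w[unfolded spec[OF \<xi>, of i]]] unfolding b_def by (auto simp: not_less)
  have b_ge: "\<xi> i \<le> b i" "nb (\<tau> \<xi> i) \<le> b i" for i unfolding b_def bnd_def by auto
  have \<xi>_mono: "\<xi> i < \<xi> j" if "i < j" for i j using b\<xi>[OF that] b_ge(1)[of i] by simp
  have \<xi>_less_iff: "\<xi> i < \<xi> j \<longleftrightarrow> i < j" for i j
    using \<xi>_mono by (metis less_asym neq_iff)
  have \<rho>_limit: "\<exists>i<\<rho>. j < i" if "j < \<rho>" for j using cof_gt_limit[OF \<rho>(2) \<mu>'(4) that] .
  define \<delta> where "\<delta> = \<xi> \<rho>"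
  have \<delta>_unb: "\<exists>i<\<rho>. w < \<xi> i" if "w < \<delta>" for w
    using \<xi>b[OF that[unfolded \<delta>_def]] \<rho>_limit b\<xi> by (meson le_less_trans)
  have cof\<delta>: "cof_gt \<delta> \<mu>'"
    by (rule cof_gt_image[OF \<rho>(2), of \<xi>]) (use \<xi>_mono \<delta>_unb \<delta>_def in auto)
  have clubR: "club \<delta> (\<xi> ` {..<\<rho>})"
    unfolding club_def
  proof (intro conjI allI impI)
    show "\<xi> ` {..<\<rho>} \<subseteq> {..<\<delta>}" unfolding \<delta>_def using \<xi>_mono by auto
    show "\<And>z. z < \<delta> \<Longrightarrow> \<exists>e\<in>\<xi> ` {..<\<rho>}. z < e" using \<delta>_unb by blast
    fix z assume z: "z < \<delta>" "\<forall>w<z. \<exists>e\<in>\<xi> ` {..<\<rho>}. w < e \<and> e \<le> z"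
    define i where "i = (LEAST i. z \<le> \<xi> i)"
    have ex: "z \<le> \<xi> \<rho>" using z(1) unfolding \<delta>_def by simp
    have i: "z \<le> \<xi> i" unfolding i_def by (rule LeastI) (rule ex)
    obtain k where k: "k < \<rho>" "z < \<xi> k" using \<delta>_unb[OF z(1)] by blast
    have "i \<le> k" unfolding i_def by (rule Least_le) (use k in simp)
    then have "i < \<rho>" using k(1) by simp
    have "\<not> z < \<xi> i"
    proof
      assume "z < \<xi> i"
      from \<xi>b[OF this] obtain j where j: "j < i" "z \<le> b j" by blast
      have "\<xi> j < z" using not_less_Least[OF j(1)[unfolded i_def]] by simp
      then obtain l where l: "\<xi> j < \<xi> l" "\<xi> l \<le> z" using z(2) by blast
      then have "b j < \<xi> l" using b\<xi> \<xi>_less_iff by blast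
      then show False using l(2) j(2) by simp
    qed
    then show "z \<in> \<xi> ` {..<\<rho>}" using i \<open>i < \<rho>\<close> by (intro image_eqI[of _ _ i]) auto
  qed
  have "|\<xi> ` {..<\<rho>}| <o |{..<\<theta>}|"
    by (rule ordLeq_ordLess_trans[OF card_of_image seg_less[OF \<rho>(1)]])
  from f_club[OF clubR this]
  obtain E where E: "club \<delta> E" and domE: "eventually (\<lambda>a. \<forall>\<eta>\<in>E. f \<eta> a < f \<delta> a) coordinates" by blast
  have "club \<rho> {i\<in>{..<\<rho>}. \<xi> i \<in> E}"
    unfolding club_def
  proof (intro conjI allI impI)
    fix z assume z: "z < \<rho>"
    have "\<xi> z < \<delta>" unfolding \<delta>_def using \<xi>_mono[OF z] .
    from club_unbounded[OF club_Int[OF cof\<delta> \<mu>'(4) E clubR] this]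
    obtain i where "i < \<rho>" "\<xi> i \<in> E" "\<xi> z < \<xi> i" by blast
    then show "\<exists>e\<in>{i\<in>{..<\<rho>}. \<xi> i \<in> E}. z < e" using \<xi>_less_iff by blast
  next
    fix z assume z: "z < \<rho>" "\<forall>w<z. \<exists>e\<in>{i\<in>{..<\<rho>}. \<xi> i \<in> E}. w < e \<and> e \<le> z"
    have "\<exists>e\<in>E. w < e \<and> e \<le> \<xi> z" if "w < \<xi> z" for w
    proof -
      obtain j where j: "j < z" "w \<le> b j" using \<xi>b[OF \<open>w < \<xi> z\<close>] by blast
      obtain e where e: "\<xi> e \<in> E" "j < e" "e \<le> z" using z(2) j(1) by blast
      have "w < \<xi> e" using b\<xi>[OF e(2)] j(2) by simp
      moreover have "\<xi> e \<le> \<xi> z" using e(3) \<xi>_mono by (metis le_less)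
      ultimately show ?thesis using e(1) by blast
    qed
    moreover have "\<xi> z < \<delta>" unfolding \<delta>_def using \<xi>_mono[OF z(1)] .
    ultimately have "\<xi> z \<in> E" using E unfolding club_def by simp
    then show "z \<in> {i\<in>{..<\<rho>}. \<xi> i \<in> E}" using z(1) by simp
  qed auto
  from guess[OF this] obtain t where t: "t \<in> T" "C t \<subseteq> {i\<in>{..<\<rho>}. \<xi> i \<in> E}" by blast
  define D where "D = {i\<in>C t. \<exists>j\<in>C t. i < j}"
  define nxt where "nxt i = (LEAST j. j \<in> C t \<and> i < j)" for i
  have nxt: "nxt i \<in> C t \<and> i < nxt i" if "i \<in> D" for i
    unfolding nxt_def by (rule LeastI_ex) (use that D_def in blast)
  have nxt_le: "nxt i \<le> j" if "j \<in> C t" "i < j" for i j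
    unfolding nxt_def by (rule Least_le) (use that in blast)
  have "\<exists>a s. a \<in> K \<and> s \<in> S a \<and> (\<forall>k\<in>C t. k \<le> i \<longrightarrow> f (\<xi> k) a < s) \<and> s < f (\<xi> (nxt i)) a"
    if i: "i \<in> D" for i
  proof -
    let ?X = "\<xi> ` (C t \<inter> {..i})"
    \<comment> \<open>The guess lies in the club, so \<delta> dominates \<open>?X\<close>, and hence
      the chosen \<open>\<sigma> ?X\<close> does too.\<close>
    have "dom \<delta> ?X" unfolding dom_def
      by (rule eventually_mono[OF domE]) (use t(2) in auto)
    then have "dom (\<sigma> ?X) ?X" unfolding \<sigma>_def by (rule someI)
    then have 1: "eventually (\<lambda>a. \<forall>\<eta>\<in>?X. f \<eta> a < f (\<sigma> ?X) a) coordinates" unfolding dom_def .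
    have 2: "eventually (\<lambda>a. f (\<sigma> ?X) a < f (\<tau> \<xi> i) a) coordinates" by (rule f_mono[OF \<tau>[OF t(1)]])
    have "nb (\<tau> \<xi> i) < \<xi> (nxt i)" using b_ge(2)[of i] b\<xi>[of i "nxt i"] nxt[OF i] by (meson le_less_trans)
    from f_mono[OF this]
    have 3: "eventually (\<lambda>a. f (nb (\<tau> \<xi> i)) a < f (\<xi> (nxt i)) a) coordinates" .
    have "frequently (\<lambda>a. \<exists>s. a \<in> K \<and> s \<in> S a \<and> (\<forall>k\<in>C t. k \<le> i \<longrightarrow> f (\<xi> k) a < s) \<and> s < f (\<xi> (nxt i)) a) coordinates"
    proof (rule frequently_rev_mp[OF nb[of "\<tau> \<xi> i"]])
      show "eventually (\<lambda>a. (\<exists>s\<in>S a. f (\<tau> \<xi> i) a \<le> s \<and> s < f (nb (\<tau> \<xi> i)) a) \<longrightarrow>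
         (\<exists>s. a \<in> K \<and> s \<in> S a \<and> (\<forall>k\<in>C t. k \<le> i \<longrightarrow> f (\<xi> k) a < s) \<and> s < f (\<xi> (nxt i)) a)) coordinates"
        using 1 2 3 eventually_K
      proof eventually_elim
        case (elim a)
        show ?case
        proof
          assume "\<exists>s\<in>S a. f (\<tau> \<xi> i) a \<le> s \<and> s < f (nb (\<tau> \<xi> i)) a"
          then obtain s where s: "s \<in> S a" "f (\<tau> \<xi> i) a \<le> s" "s < f (nb (\<tau> \<xi> i)) a" by blast
          have "f (\<xi> k) a < s" if "k \<in> C t" "k \<le> i" for k
          proof -
            have "f (\<xi> k) a < f (\<sigma> ?X) a" using elim(1) that by blast
            also have "\<dots> < f (\<tau> \<xi> i) a" by (rule elim(2))
            finally show ?thesis using s(2) by simp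
          qed
          moreover have "s < f (\<xi> (nxt i)) a" using s(3) elim(3) by simp
          ultimately show "\<exists>s. a \<in> K \<and> s \<in> S a \<and> (\<forall>k\<in>C t. k \<le> i \<longrightarrow> f (\<xi> k) a < s) \<and> s < f (\<xi> (nxt i)) a"
            using s(1) elim(4) by blast
        qed
      qed
    qed
    from frequently_ex[OF this] show ?thesis by blast
  qed
  then have "\<forall>i\<in>D. \<exists>p. fst p \<in> K \<and> snd p \<in> S (fst p) \<and>
      (\<forall>k\<in>C t. k \<le> i \<longrightarrow> f (\<xi> k) (fst p) < snd p) \<and> snd p < f (\<xi> (nxt i)) (fst p)"
    by (metis fst_conv snd_conv)
  from bchoice[OF this] obtain p where p: "\<And>i. i \<in> D \<Longrightarrow> fst (p i) \<in> K"
    "\<And>i. i \<in> D \<Longrightarrow> snd (p i) \<in> S (fst (p i))"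
    "\<And>i k. i \<in> D \<Longrightarrow> k \<in> C t \<Longrightarrow> k \<le> i \<Longrightarrow> f (\<xi> k) (fst (p i)) < snd (p i)"
    "\<And>i. i \<in> D \<Longrightarrow> snd (p i) < f (\<xi> (nxt i)) (fst (p i))" by blast
  have p_neq: "p i \<noteq> p j" if ij: "i \<in> D" "j \<in> D" "i < j" for i j
  proof
    assume eq: "p i = p j"
    have jC: "j \<in> C t" using ij(2) unfolding D_def by simp
    have "snd (p i) < f (\<xi> (nxt i)) (fst (p i))" by (rule p(4)[OF ij(1)])
    also have "\<dots> = f (\<xi> (nxt i)) (fst (p j))" using eq by simp
    also have "\<dots> < snd (p j)" by (rule p(3)[OF ij(2) conjunct1[OF nxt[OF ij(1)]] nxt_le[OF jC ij(3)]])
    finally show False using eq by simp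
  qed
  then have inj: "inj_on p D" by (intro inj_onI) (metis neq_iff)
  have "|D| \<le>o |\<Union>a\<in>K. Pair a ` S a|"
    by (rule card_of_ordLeqI[OF inj]) (use p(1,2) in \<open>force intro!: image_eqI\<close>)
  also have "|\<Union>a\<in>K. Pair a ` S a| \<le>o |{..<x}|"
    by (rule card_of_UN_le[OF x(2) Kx card_of_image_le[OF S]])
  finally have "|D| \<le>o |{..<x}|" .
  moreover have "finite (C t - D)"
  proof (cases "C t - D = {}")
    case False
    then obtain m where m: "m \<in> C t - D" by blast
    have "C t - D \<subseteq> {m}" using m unfolding D_def by (auto simp: not_less intro: antisym)
    then show ?thesis using finite_subset by blast
  qed (metis finite.emptyI)
  ultimately have "|D \<union> (C t - D)| \<le>o |{..<x}|"
    by (rule card_of_Un_le[OF x(2) _ card_of_finite_le[OF x(2)]])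
  then have "|C t| \<le>o |{..<x}|" by (rule card_of_subset_le) blast
  then show False using large[OF t(1)] by simp
qed

end

section \<open>Exact upper bounds\<close>

context dominating_sequence
begin

definition upper :: "('k \<Rightarrow> 'k) \<Rightarrow> bool" where
  "upper g \<longleftrightarrow> (\<forall>\<alpha>. eventually (\<lambda>a. f \<alpha> a \<le> g a) coordinates)"

definition least_upper :: "('k \<Rightarrow> 'k) \<Rightarrow> bool" where
  "least_upper g \<longleftrightarrow> upper g \<and> (\<forall>h. upper h \<longrightarrow> eventually (\<lambda>a. g a \<le> h a) coordinates)"

lemma upperI:
  assumes "\<And>\<beta>. \<alpha> < \<beta> \<Longrightarrow> eventually (\<lambda>a. f \<beta> a \<le> g a) coordinates"
  shows "upper g"
  unfolding upper_def
proof
  fix \<gamma>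
  obtain \<beta> where "max \<alpha> \<gamma> < \<beta>" using no_max by blast
  then have "eventually (\<lambda>a. f \<beta> a \<le> g a) coordinates" "eventually (\<lambda>a. f \<gamma> a < f \<beta> a) coordinates"
    using assms f_mono by auto
  then show "eventually (\<lambda>a. f \<gamma> a \<le> g a) coordinates" by eventually_elim simp
qed

text \<open>Otherwise upper bounds \<open>g \<zeta>\<close> are built for \<zeta> below
  \<open>csucc x\<^sub>0\<close>, each frequently below a projection of the sequence to the values
  of the earlier ones. The projections decrease in \<zeta> and must stabilize on all of
  \<open>K\<close>, which leaves no room for the strict drop.\<close>

lemma least_upper_exists: "\<exists>g. least_upper g"
proof (rule ccontr)
  assume "\<not> ?thesis"
  then have neg: "\<exists>u. upper u \<and> frequently (\<lambda>a. u a < h a) coordinates" if "upper h" for h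
    using that unfolding least_upper_def frequently_def by (auto simp: not_less)
  define \<mu> where "\<mu> = csucc x\<^sub>0"
  have \<mu>: "\<mu> < \<theta>" "cof_gt \<mu> x\<^sub>0"
    unfolding \<mu>_def using csucc_less cof_gt_csucc' x0_less x0_infinite by blast+
  \<comment> \<open>\<theta> is a default value that keeps the projection of each
    \<open>f \<alpha> a\<close> defined.\<close>
  define S where "S g \<zeta> a = insert \<theta> ((\<lambda>\<zeta>'. g \<zeta>' a) ` {..<\<zeta>})" for g :: "'k \<Rightarrow> 'k \<Rightarrow> 'k" and \<zeta> a
  define proj where "proj \<alpha> g \<zeta> a = (LEAST s. s \<in> S g \<zeta> a \<and> f \<alpha> a \<le> s)" for \<alpha> g \<zeta> a
  have proj: "proj \<alpha> g \<zeta> a \<in> S g \<zeta> a" "f \<alpha> a \<le> proj \<alpha> g \<zeta> a" if "a \<in> K" for \<alpha> g \<zeta> a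
  proof -
    have "\<theta> \<in> S g \<zeta> a \<and> f \<alpha> a \<le> \<theta>" unfolding S_def using f_less[OF that] by (simp add: less_imp_le)
    then have "proj \<alpha> g \<zeta> a \<in> S g \<zeta> a \<and> f \<alpha> a \<le> proj \<alpha> g \<zeta> a"
      unfolding proj_def by (rule LeastI)
    then show "proj \<alpha> g \<zeta> a \<in> S g \<zeta> a" "f \<alpha> a \<le> proj \<alpha> g \<zeta> a" by auto
  qed
  have proj_le: "proj \<alpha> g \<zeta> a \<le> s" if "s \<in> S g \<zeta> a" "f \<alpha> a \<le> s" for \<alpha> g \<zeta> a s
    unfolding proj_def by (rule Least_le) (use that in simp)
  have cardS: "|S g \<zeta> a| \<le>o |{..<x\<^sub>0}|" if "\<zeta> < \<mu>" for g \<zeta> a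
  proof -
    have "|{..<\<zeta>}| \<le>o |{..<x\<^sub>0}|" using seg_below_csucc[OF x0_less] that unfolding \<mu>_def by blast
    from card_of_Un_le[OF x0_infinite card_of_finite_le[OF x0_infinite, of "{\<theta>}"] card_of_image_le[OF this]]
    show ?thesis unfolding S_def by simp
  qed
  have "\<exists>g. \<forall>\<zeta>. \<zeta> < \<mu> \<longrightarrow> upper (g \<zeta>) \<and>
      (\<exists>\<alpha>. upper (proj \<alpha> g \<zeta>) \<and> frequently (\<lambda>a. g \<zeta> a < proj \<alpha> g \<zeta> a) coordinates)"
  proof (rule dependent_wellorder_choice)
    fix u :: "'k \<Rightarrow> 'k" and g g' :: "'k \<Rightarrow> 'k \<Rightarrow> 'k" and \<zeta> :: 'k
    assume *: "\<And>y. y < \<zeta> \<Longrightarrow> g y = g' y"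
    have "S g \<zeta> a = S g' \<zeta> a" for a
      unfolding S_def by (rule arg_cong[of _ _ "insert \<theta>"], rule image_cong[OF refl]) (simp add: *)
    then have "proj \<alpha> g \<zeta> = proj \<alpha> g' \<zeta>" for \<alpha> unfolding proj_def by simp
    then show "(\<zeta> < \<mu> \<longrightarrow> upper u \<and>
          (\<exists>\<alpha>. upper (proj \<alpha> g \<zeta>) \<and> frequently (\<lambda>a. u a < proj \<alpha> g \<zeta> a) coordinates)) =
        (\<zeta> < \<mu> \<longrightarrow> upper u \<and>
          (\<exists>\<alpha>. upper (proj \<alpha> g' \<zeta>) \<and> frequently (\<lambda>a. u a < proj \<alpha> g' \<zeta> a) coordinates))" by simp
  next
    fix g :: "'k \<Rightarrow> 'k \<Rightarrow> 'k" and \<zeta> :: 'k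
    show "\<exists>u. \<zeta> < \<mu> \<longrightarrow> upper u \<and>
        (\<exists>\<alpha>. upper (proj \<alpha> g \<zeta>) \<and> frequently (\<lambda>a. u a < proj \<alpha> g \<zeta> a) coordinates)"
    proof (cases "\<zeta> < \<mu>")
      case True
      \<comment> \<open>Past \<alpha>, the sequence eventually crosses no point of
        \<open>S g \<zeta> a\<close>, so the projection of \<open>f \<alpha>\<close> is an upper
        bound, and \<open>neg\<close> gives one that is frequently below it.\<close>
      obtain \<alpha> where \<alpha>: "\<forall>\<beta>>\<alpha>. eventually (\<lambda>a. \<not> (\<exists>s\<in>S g \<zeta> a. f \<alpha> a \<le> s \<and> s < f \<beta> a)) coordinates"
        using interval_avoidance[OF x0_less x0_infinite K_card, of "S g \<zeta>"] cardS[OF True] by blast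
      have up: "upper (proj \<alpha> g \<zeta>)"
      proof (rule upperI)
        fix \<beta> assume "\<alpha> < \<beta>"
        then have "eventually (\<lambda>a. \<not> (\<exists>s\<in>S g \<zeta> a. f \<alpha> a \<le> s \<and> s < f \<beta> a)) coordinates" using \<alpha> by blast
        then show "eventually (\<lambda>a. f \<beta> a \<le> proj \<alpha> g \<zeta> a) coordinates"
          using eventually_K by eventually_elim (use proj in \<open>meson not_less\<close>)
      qed
      then show ?thesis using neg[OF up] by blast
    qed blast
  qed
  then obtain g where g: "\<And>\<zeta>. \<zeta> < \<mu> \<Longrightarrow> upper (g \<zeta>)"
    and "\<forall>\<zeta>. \<exists>\<alpha>. \<zeta> < \<mu> \<longrightarrow> upper (proj \<alpha> g \<zeta>) \<and> frequently (\<lambda>a. g \<zeta> a < proj \<alpha> g \<zeta> a) coordinates"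
    by blast
  from choice[OF this(2)] obtain A where A: "\<And>\<zeta>. \<zeta> < \<mu> \<Longrightarrow> upper (proj (A \<zeta>) g \<zeta>)"
    and A': "\<And>\<zeta>. \<zeta> < \<mu> \<Longrightarrow> frequently (\<lambda>a. g \<zeta> a < proj (A \<zeta>) g \<zeta> a) coordinates" by blast
  \<comment> \<open>One \<alpha> replaces all \<open>A \<zeta>\<close>: \<open>f \<alpha>\<close>
    lies between \<open>f (A \<zeta>)\<close> and its projection, so almost everywhere both have the
    same projection.\<close>
  obtain \<alpha> where \<alpha>: "\<forall>\<zeta>\<in>{..<\<mu>}. A \<zeta> < \<alpha>" using bounded_family[OF seg_le, of \<mu> A] by blast
  have eq: "eventually (\<lambda>a. proj \<alpha> g \<zeta> a = proj (A \<zeta>) g \<zeta> a) coordinates" if \<zeta>: "\<zeta> < \<mu>" for \<zeta>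
  proof -
    have 1: "eventually (\<lambda>a. f \<alpha> a \<le> proj (A \<zeta>) g \<zeta> a) coordinates" using A[OF \<zeta>] unfolding upper_def ..
    have 2: "eventually (\<lambda>a. f (A \<zeta>) a < f \<alpha> a) coordinates" by (rule f_mono) (use \<alpha> \<zeta> in simp)
    show ?thesis using 1 2 eventually_K
    proof eventually_elim
      case (elim a)
      have "proj \<alpha> g \<zeta> a \<le> proj (A \<zeta>) g \<zeta> a" by (rule proj_le[OF proj(1)[OF elim(3)] elim(1)])
      moreover have "proj (A \<zeta>) g \<zeta> a \<le> proj \<alpha> g \<zeta> a"
        by (rule proj_le[OF proj(1)[OF elim(3)]])
          (use proj(2)[OF elim(3), of \<alpha> g \<zeta>] elim(2) in simp)
      ultimately show ?case by simp
    qed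
  qed
  have anti: "proj \<alpha> g \<zeta>' a \<le> proj \<alpha> g \<zeta> a" if "a \<in> K" "\<zeta> \<le> \<zeta>'" for a \<zeta> \<zeta>'
  proof (rule proj_le)
    have "S g \<zeta> a \<subseteq> S g \<zeta>' a" unfolding S_def using that(2) by auto
    then show "proj \<alpha> g \<zeta> a \<in> S g \<zeta>' a" using proj(1)[OF that(1)] by blast
  qed (rule proj(2)[OF that(1)])
  have "\<exists>\<zeta><\<mu>. \<forall>\<zeta>'. \<zeta> \<le> \<zeta>' \<longrightarrow> \<zeta>' < \<mu> \<longrightarrow> (\<forall>a\<in>K. proj \<alpha> g \<zeta>' a = proj \<alpha> g \<zeta> a)"
    by (rule simultaneous_stabilization[OF \<mu>(2) K_card]) (rule anti)
  then obtain \<zeta> where \<zeta>: "\<zeta> < \<mu>"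
    "\<forall>\<zeta>'. \<zeta> \<le> \<zeta>' \<longrightarrow> \<zeta>' < \<mu> \<longrightarrow> (\<forall>a\<in>K. proj \<alpha> g \<zeta>' a = proj \<alpha> g \<zeta> a)"
    by (elim exE conjE)
  obtain \<zeta>' where \<zeta>': "\<zeta>' < \<mu>" "\<zeta> < \<zeta>'" using cof_gt_limit[OF \<mu>(2) x0_infinite \<zeta>(1)] by blast
  have stable: "proj \<alpha> g \<zeta>' a = proj \<alpha> g \<zeta> a" if "a \<in> K" for a
    using \<zeta>(2)[rule_format, OF less_imp_le[OF \<zeta>'(2)] \<zeta>'(1) that] .
  \<comment> \<open>\<open>g \<zeta>\<close> is among the points projected to at the later stage
    \<open>\<zeta>'\<close>, so the stable projection is at most \<open>g \<zeta>\<close>, against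
    the choice of \<open>g \<zeta>\<close>.\<close>
  have "eventually (\<lambda>a. f \<alpha> a \<le> g \<zeta> a) coordinates" using g[OF \<zeta>(1)] unfolding upper_def ..
  then have "eventually (\<lambda>a. \<not> g \<zeta> a < proj (A \<zeta>) g \<zeta> a) coordinates"
    using eq[OF \<zeta>(1)] eventually_K
  proof eventually_elim
    case (elim a)
    have "proj \<alpha> g \<zeta>' a \<le> g \<zeta> a"
      by (rule proj_le[OF _ elim(1)]) (use \<zeta>'(2) S_def in simp)
    then show ?case using stable[OF elim(3)] elim(2) by simp
  qed
  then show False using A'[OF \<zeta>(1)] unfolding frequently_def by simp
qed

lemma least_upper_greater:
  assumes "least_upper g"
  shows "eventually (\<lambda>a. f \<alpha> a < g a) coordinates"
proof -
  obtain \<beta> where "\<alpha> < \<beta>" using no_max by blast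
  then have "eventually (\<lambda>a. f \<alpha> a < f \<beta> a) coordinates" "eventually (\<lambda>a. f \<beta> a \<le> g a) coordinates"
    using f_mono assms unfolding least_upper_def upper_def by blast+
  then show ?thesis by eventually_elim simp
qed

text \<open>Apply avoidance to the singletons \<open>{d a}\<close>: replacing \<open>g\<close> by
  \<open>d\<close> where \<open>f \<alpha>\<close> is at most \<open>d\<close> still gives an upper
  bound, and minimality of \<open>g\<close> makes such coordinates negligible.\<close>

lemma least_upper_exact:
  assumes g: "least_upper g" and d: "eventually (\<lambda>a. d a < g a) coordinates"
  shows "\<exists>\<alpha>. eventually (\<lambda>a. d a < f \<alpha> a) coordinates"
proof -
  have "\<exists>\<alpha>. \<forall>\<beta>>\<alpha>. eventually (\<lambda>a. \<not> (\<exists>s\<in>{d a}. f \<alpha> a \<le> s \<and> s < f \<beta> a)) coordinates"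
    by (rule interval_avoidance[OF x0_less x0_infinite K_card card_of_finite_le[OF x0_infinite]]) simp
  then obtain \<alpha> where \<alpha>: "\<forall>\<beta>>\<alpha>. eventually (\<lambda>a. \<not> (f \<alpha> a \<le> d a \<and> d a < f \<beta> a)) coordinates" by auto
  have "upper (\<lambda>a. if f \<alpha> a \<le> d a then d a else g a)"
  proof (rule upperI)
    fix \<beta> assume "\<alpha> < \<beta>"
    then have "eventually (\<lambda>a. \<not> (f \<alpha> a \<le> d a \<and> d a < f \<beta> a)) coordinates" using \<alpha> by blast
    moreover have "eventually (\<lambda>a. f \<beta> a < g a) coordinates" by (rule least_upper_greater[OF g])
    ultimately show "eventually (\<lambda>a. f \<beta> a \<le> (if f \<alpha> a \<le> d a then d a else g a)) coordinates"
      by eventually_elim auto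
  qed
  then have "eventually (\<lambda>a. g a \<le> (if f \<alpha> a \<le> d a then d a else g a)) coordinates"
    using g unfolding least_upper_def by blast
  then have "eventually (\<lambda>a. d a < f \<alpha> a) coordinates"
    using d by eventually_elim (auto split: if_splits)
  then show ?thesis ..
qed

text \<open>At a coordinate of small cofinality take a small cofinal set \<open>S a\<close> below
  \<open>g a\<close>. The projection of \<open>f \<alpha> a\<close> to it lies below
  \<open>g a\<close> yet bounds the later values, so such coordinates are negligible by minimality
  of \<open>g\<close>.\<close>

lemma least_upper_cof_gt:
  assumes g: "least_upper g" and x: "x < \<theta>"
  shows "eventually (\<lambda>a. cof_gt (g a) x) coordinates"
proof -
  define y where "y = max x x\<^sub>0"
  have y: "y < \<theta>" "x \<le> y" "x\<^sub>0 \<le> y" unfolding y_def using x x0_less by auto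
  have infy: "infinite {..<y}" by (rule infinite_above[OF x0_infinite y(3)])
  have Ky: "|K| \<le>o |{..<y}|" by (rule ordLeq_transitive[OF K_card seg_mono[OF y(3)]])
  define bad where "bad a Y \<longleftrightarrow> Y \<subseteq> {..<g a} \<and> |Y| \<le>o |{..<y}| \<and> (\<forall>z<g a. \<exists>s\<in>Y. z \<le> s)" for a Y
  define S where "S a = (if Ex (bad a) then SOME Y. bad a Y else {})" for a
  have S: "bad a (S a)" if "Ex (bad a)" for a
    unfolding S_def using that by (simp add: someI_ex)
  have "|S a| \<le>o |{..<y}|" for a
  proof (cases "Ex (bad a)")
    case True
    from S[OF this] show ?thesis unfolding bad_def by blast
  next
    case False
    then have "S a = {}" unfolding S_def by (rule if_not_P)
    then show ?thesis by (simp add: card_of_empty)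
  qed
  then obtain \<alpha> where \<alpha>: "\<forall>\<beta>>\<alpha>. eventually (\<lambda>a. \<not> (\<exists>s\<in>S a. f \<alpha> a \<le> s \<and> s < f \<beta> a)) coordinates"
    using interval_avoidance[OF y(1) infy Ky] by blast
  define p where "p a = (LEAST s. s \<in> S a \<and> f \<alpha> a \<le> s)" for a
  have p: "p a \<in> S a" "f \<alpha> a \<le> p a" "p a < g a" if "Ex (bad a)" "f \<alpha> a < g a" for a
  proof -
    have "\<exists>s. s \<in> S a \<and> f \<alpha> a \<le> s" using S[OF that(1)] that(2) unfolding bad_def by blast
    then have "p a \<in> S a \<and> f \<alpha> a \<le> p a" unfolding p_def by (rule LeastI_ex)
    then show "p a \<in> S a" "f \<alpha> a \<le> p a" "p a < g a" using S[OF that(1)] unfolding bad_def by auto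
  qed
  have "upper (\<lambda>a. if Ex (bad a) then p a else g a)"
  proof (rule upperI)
    fix \<beta> assume "\<alpha> < \<beta>"
    then have "eventually (\<lambda>a. \<not> (\<exists>s\<in>S a. f \<alpha> a \<le> s \<and> s < f \<beta> a)) coordinates" using \<alpha> by blast
    then show "eventually (\<lambda>a. f \<beta> a \<le> (if Ex (bad a) then p a else g a)) coordinates"
      using least_upper_greater[OF g, of \<alpha>] least_upper_greater[OF g, of \<beta>]
    proof eventually_elim
      case (elim a)
      show ?case
      proof (cases "Ex (bad a)")
        case True
        then show ?thesis using p(1,2)[OF True elim(2)] elim(1) by (auto simp: not_less)
      next
        case False
        show ?thesis unfolding if_not_P[OF False] by (rule less_imp_le[OF elim(3)])
      qed
    qed
  qed
  then have "eventually (\<lambda>a. g a \<le> (if Ex (bad a) then p a else g a)) coordinates"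
    using g unfolding least_upper_def by blast
  then show ?thesis using least_upper_greater[OF g, of \<alpha>]
  proof eventually_elim
    case (elim a)
    have "\<not> Ex (bad a)"
    proof
      assume bad: "Ex (bad a)"
      have "g a \<le> p a" using elim(1) unfolding if_P[OF bad] .
      then show False using p(3)[OF bad elim(2)] by simp
    qed
    then have "cof_gt (g a) y" unfolding cof_gt_def bad_def by (auto simp: not_le)
    then show ?case using y(2) by (rule cof_gt_mono)
  qed
qed

end

section \<open>The colouring\<close>

definition unbounded :: "'k::wellorder set \<Rightarrow> bool" where
  "unbounded A \<longleftrightarrow> (\<forall>z. \<exists>a\<in>A. z < a)"

text \<open>The ideal-free core of the theorem. In the application \<open>D \<eta>\<close> is the
  set of colours that \<eta> attains positively on one of the sets \<open>B \<tau>\<close>.\<close>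

definition evades_small_sets :: "'k::wellorder \<Rightarrow> ('k \<Rightarrow> 'k \<Rightarrow> 'k) \<Rightarrow> bool" where
  "evades_small_sets \<theta> c \<longleftrightarrow> (\<forall>A B D m. unbounded A \<longrightarrow> unbounded B \<longrightarrow> m < \<theta> \<longrightarrow>
     (\<forall>\<eta>\<in>A. |D \<eta> :: 'k set| \<le>o |{..<m}| ) \<longrightarrow> (\<exists>\<eta>\<in>A. \<exists>\<beta>\<in>B. \<eta> < \<beta> \<and> c \<eta> \<beta> \<notin> D \<eta>))"

context dominating_sequence
begin

lemma csucc_mono:
  assumes "x \<le> y" "y < \<theta>"
  shows "csucc x \<le> csucc y"
  by (rule csucc_le, rule ordLeq_ordLess_trans[OF seg_mono[OF assms(1)] seg_csucc[OF assms(2)]])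

lemma evading_colouring_of_sequence: "\<exists>c. colouring \<theta> c \<and> evades_small_sets \<theta> c"
proof -
  obtain g where g: "least_upper g" using least_upper_exists ..
  \<comment> \<open>From coordinate \<open>\<pi> x\<close> on, the cofinality of \<open>g\<close>
    exceeds \<open>csucc x\<close>, which is the size allowed for the colours collected at level
    \<open>x\<close>.\<close>
  define good where "good x i \<longleftrightarrow> i \<in> K \<and> x \<le> i \<and> (\<forall>a\<in>K. i \<le> a \<longrightarrow> cof_gt (g a) (csucc x))" for x i
  define \<pi> where "\<pi> x = (LEAST i. good x i)" for x
  have good\<pi>: "good x (\<pi> x)" if x: "x < \<theta>" for x
  proof -
    obtain n where n: "n < \<theta>" "\<forall>a\<in>K. n \<le> a \<longrightarrow> cof_gt (g a) (csucc x)"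
      using least_upper_cof_gt[OF g csucc_less[OF x]] unfolding eventually_coordinates by blast
    obtain i where "i \<in> K" "max n x < i" using K_unbounded[of "max n x"] n(1) x by auto
    then have "good x i" unfolding good_def using n(2) by auto
    then show ?thesis unfolding \<pi>_def by (rule LeastI)
  qed
  have \<pi>_mono: "\<pi> x \<le> \<pi> y" if xy: "x \<le> y" "y < \<theta>" for x y
  proof -
    have "good x (\<pi> y)"
      using good\<pi>[OF xy(2)] cof_gt_mono[OF _ csucc_mono[OF xy]] xy(1) unfolding good_def by auto
    then show ?thesis unfolding \<pi>_def[of x] by (rule Least_le)
  qed
  define c where "c \<eta> \<beta> = f \<beta> (\<pi> (enum \<beta> \<eta>))" for \<eta> \<beta>
  have "colouring \<theta> c"
    unfolding colouring_def c_def using f_less good\<pi> enum(2) unfolding good_def by blast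
  moreover have "evades_small_sets \<theta> c"
    unfolding evades_small_sets_def
  proof (intro allI impI)
    fix A B :: "'k set" and D :: "'k \<Rightarrow> 'k set" and m
    assume A: "unbounded A" and B: "unbounded B" and m: "m < \<theta>" and D: "\<forall>\<eta>\<in>A. |D \<eta>| \<le>o |{..<m}|"
    \<comment> \<open>A set of \<open>csucc x\<close> many \<eta>: few enough to bound their colours
      below \<open>g\<close>, but too many for \<open>enum \<beta>\<close> to keep them all below
      \<open>x\<close>.\<close>
    have "\<exists>X\<subseteq>A. |X| \<le>o |{..<csucc x}| \<and> \<not> |X| \<le>o |{..<x}|" if x: "x \<in> K" for x
    proof -
      have "\<not> |A| \<le>o |{..<\<theta>}|"
      proof
        assume "|A| \<le>o |{..<\<theta>}|"
        from bounded[OF this] obtain z where "\<forall>y\<in>A. y < z" ..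
        then show False using A unfolding unbounded_def by (meson less_asym)
      qed
      then have "|{..<csucc x}| \<le>o |A|"
        using not_ordLess_card seg_le ordLess_imp_ordLeq ordLeq_ordLess_trans by blast
      then obtain i where i: "inj_on i {..<csucc x}" "i ` {..<csucc x} \<subseteq> A"
        unfolding card_of_ordLeq[symmetric] by blast
      have "|{..<csucc x}| \<le>o |i ` {..<csucc x}|" by (rule card_of_ordLeqI[OF i(1)]) simp
      then have "\<not> |i ` {..<csucc x}| \<le>o |{..<x}|"
        using seg_csucc[OF K_less[OF x]] not_ordLess_card ordLeq_transitive by blast
      then show ?thesis using i(2) card_of_image by blast
    qed
    then have "\<forall>x\<in>K. \<exists>X. X \<subseteq> A \<and> |X| \<le>o |{..<csucc x}| \<and> \<not> |X| \<le>o |{..<x}|" by blast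
    from bchoice[OF this] obtain X where X: "\<And>x. x \<in> K \<Longrightarrow> X x \<subseteq> A"
      "\<And>x. x \<in> K \<Longrightarrow> |X x| \<le>o |{..<csucc x}|" "\<And>x. x \<in> K \<Longrightarrow> \<not> |X x| \<le>o |{..<x}|" by blast
    define S where "S x = (\<Union>\<eta>\<in>X x. D \<eta>)" for x
    have S: "|S x| \<le>o |{..<csucc x}|" if x: "x \<in> K" "m \<le> x" for x
      unfolding S_def
    proof (rule card_of_UN_le[OF infinite_above[OF K_infinite[OF x(1)] le_csucc[OF K_less[OF x(1)]]] X(2)[OF x(1)]])
      fix \<eta> assume "\<eta> \<in> X x"
      then have "|D \<eta>| \<le>o |{..<m}|" using D X(1)[OF x(1)] by blast
      moreover have "m \<le> csucc x" using x(2) le_csucc[OF K_less[OF x(1)]] by simp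
      ultimately show "|D \<eta>| \<le>o |{..<csucc x}|" using ordLeq_transitive seg_mono by blast
    qed
    \<comment> \<open>\<open>z\<close> bounds the colours below \<open>g i\<close> from all levels
      \<open>x\<close> with \<open>\<pi> x \<le> i\<close>; the bounds of these at most |K| levels
      combine once the cofinality of \<open>g i\<close> exceeds \<open>x\<^sub>0\<close>.\<close>
    define Q where "Q i z \<longleftrightarrow> (\<forall>x\<in>K. m \<le> x \<longrightarrow> \<pi> x \<le> i \<longrightarrow> (\<forall>s\<in>S x. s < g i \<longrightarrow> s < z))" for i z
    have "eventually (\<lambda>i. \<exists>z. z < g i \<and> Q i z) coordinates"
      using least_upper_cof_gt[OF g x0_less] eventually_K
    proof eventually_elim
      case (elim i)
      have "\<forall>x\<in>{x\<in>K. m \<le> x \<and> \<pi> x \<le> i}. \<exists>z. z < g i \<and> (\<forall>s\<in>S x. s < g i \<longrightarrow> s < z)"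
      proof
        fix x assume x: "x \<in> {x\<in>K. m \<le> x \<and> \<pi> x \<le> i}"
        have "cof_gt (g i) (csucc x)" using good\<pi>[OF K_less] x elim(2) unfolding good_def by blast
        moreover have "|S x \<inter> {..<g i}| \<le>o |{..<csucc x}|"
          by (rule card_of_subset_le[OF S]) (use x in auto)
        ultimately have "\<exists>z<g i. \<forall>s\<in>S x \<inter> {..<g i}. s < z"
          by (intro cof_gt_bounded[of "g i" "csucc x"]) auto
        then show "\<exists>z. z < g i \<and> (\<forall>s\<in>S x. s < g i \<longrightarrow> s < z)" by auto
      qed
      from bchoice[OF this] obtain w
        where w: "\<And>x. x \<in> {x\<in>K. m \<le> x \<and> \<pi> x \<le> i} \<Longrightarrow> w x < g i"
          and w': "\<And>x s. x \<in> {x\<in>K. m \<le> x \<and> \<pi> x \<le> i} \<Longrightarrow> s \<in> S x \<Longrightarrow> s < g i \<Longrightarrow> s < w x" by blast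
      have "|{x\<in>K. m \<le> x \<and> \<pi> x \<le> i}| \<le>o |{..<x\<^sub>0}|" by (rule card_of_subset_le[OF K_card]) auto
      from cof_gtD[OF elim(1) this, of w] w
      obtain z where z: "z < g i" "\<forall>x\<in>{x\<in>K. m \<le> x \<and> \<pi> x \<le> i}. w x < z" by blast
      have "Q i z" unfolding Q_def using w' z(2) by (fastforce intro: less_trans)
      then show ?case using z(1) by blast
    qed
    then have "eventually (\<lambda>i. (SOME z. z < g i \<and> Q i z) < g i \<and> Q i (SOME z. z < g i \<and> Q i z)) coordinates"
      by (rule eventually_mono) (rule someI_ex)
    then obtain d where d: "eventually (\<lambda>i. d i < g i \<and> Q i (d i)) coordinates" by fast
    then have "eventually (\<lambda>i. d i < g i) coordinates" by (rule eventually_mono) simp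
    from least_upper_exact[OF g this]
    obtain \<alpha> where \<alpha>: "eventually (\<lambda>i. d i < f \<alpha> i) coordinates" ..
    have "|\<Union>x\<in>K. X x| \<le>o |{..<\<theta>}|"
    proof (rule card_of_UN_le[OF theta_infinite])
      show "|K| \<le>o |{..<\<theta>}|" using K_card seg_le ordLeq_transitive by blast
      show "\<And>x. x \<in> K \<Longrightarrow> |X x| \<le>o |{..<\<theta>}|" using X(2) seg_le ordLeq_transitive by blast
    qed
    from bounded[OF this] obtain z where z: "\<forall>\<eta>\<in>\<Union>x\<in>K. X x. \<eta> < z" ..
    \<comment> \<open>\<beta> lies above \<alpha>, so \<open>f \<beta>\<close> eventually exceeds
      \<open>d\<close>, and above every \<open>X x\<close>, so that \<open>enum \<beta>\<close> is
      injective on each.\<close>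
    obtain \<beta> where \<beta>: "\<beta> \<in> B" "max \<alpha> z < \<beta>" using B unfolding unbounded_def by blast
    have "eventually (\<lambda>i. f \<alpha> i < f \<beta> i) coordinates" by (rule f_mono) (use \<beta>(2) in simp)
    with d \<alpha> least_upper_greater[OF g, of \<beta>]
    have "eventually (\<lambda>i. Q i (d i) \<and> d i < f \<beta> i \<and> f \<beta> i < g i) coordinates"
      by eventually_elim simp
    then obtain n where n: "n < \<theta>" "\<forall>i\<in>K. n \<le> i \<longrightarrow> Q i (d i) \<and> d i < f \<beta> i \<and> f \<beta> i < g i"
      unfolding eventually_coordinates by blast
    \<comment> \<open>\<open>x\<close> exceeds \<open>n\<close> so that the coordinate
      \<open>?i\<close>, which is at least \<open>enum \<beta> \<eta>\<close> and hence at least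
      \<open>x\<close>, lies where the comparison holds; it exceeds \<open>m\<close> so that
      \<open>Q\<close> covers \<open>S x\<close>.\<close>
    obtain x where x: "x \<in> K" "max n m < x" using K_unbounded[of "max n m"] n(1) m by auto
    have X\<beta>: "X x \<subseteq> {..<\<beta>}" using z x(1) \<beta>(2) by fastforce
    have "\<not> X x \<subseteq> {\<eta>\<in>{..<\<beta>}. enum \<beta> \<eta> < x}"
      using X(3)[OF x(1)] card_of_subset_le[OF card_enum_less[of \<beta> x], of "X x"] by blast
    with X\<beta> obtain \<eta> where "\<eta> \<in> X x" "\<eta> < \<beta>" "\<not> enum \<beta> \<eta> < x" by blast
    then have \<eta>: "\<eta> \<in> X x" "\<eta> < \<beta>" "x \<le> enum \<beta> \<eta>" by auto
    let ?i = "\<pi> (enum \<beta> \<eta>)"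
    have e: "enum \<beta> \<eta> < \<theta>" by (rule enum(2)[OF \<eta>(2)])
    have i: "?i \<in> K" "enum \<beta> \<eta> \<le> ?i" using good\<pi>[OF e] unfolding good_def by auto
    have "n \<le> ?i" using x(2) \<eta>(3) i(2) by auto
    with n(2) i(1) have i': "Q ?i (d ?i)" "d ?i < f \<beta> ?i" "f \<beta> ?i < g ?i" by auto
    have "c \<eta> \<beta> \<notin> D \<eta>"
    proof
      assume "c \<eta> \<beta> \<in> D \<eta>"
      then have "f \<beta> ?i \<in> S x" unfolding S_def c_def using \<eta>(1) by blast
      moreover have "m \<le> x" "\<pi> x \<le> ?i" using x(2) \<pi>_mono[OF \<eta>(3) e] by auto
      ultimately have "f \<beta> ?i < d ?i" using i'(1,3) x(1) unfolding Q_def by blast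
      then show False using i'(2) by simp
    qed
    then show "\<exists>\<eta>\<in>A. \<exists>\<beta>\<in>B. \<eta> < \<beta> \<and> c \<eta> \<beta> \<notin> D \<eta>" using \<eta>(1,2) X(1)[OF x(1)] \<beta>(1) by blast
  qed
  ultimately show ?thesis by blast
qed

end

section \<open>Reduction from ideals to evasion\<close>

context singular_segment
begin

lemma evading_colouring:
  "\<exists>c. colouring \<theta> c \<and> upper_regressive c \<and> evades_small_sets \<theta> c"
proof -
  obtain f :: "'k \<Rightarrow> 'k \<Rightarrow> 'k" where f: "\<forall>\<alpha>. \<forall>a\<in>K. f \<alpha> a < \<theta>"
    "\<forall>\<alpha> \<beta>. \<alpha> < \<beta> \<longrightarrow> eventually (\<lambda>a. f \<alpha> a < f \<beta> a) coordinates"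
    "\<forall>\<delta> R. club \<delta> R \<longrightarrow> |R| <o |{..<\<theta>}| \<longrightarrow>
        (\<exists>E. club \<delta> E \<and> eventually (\<lambda>a. \<forall>\<eta>\<in>E. f \<eta> a < f \<delta> a) coordinates)"
    using exists_dominating_sequence by (elim exE conjE)
  interpret dominating_sequence \<theta> K x\<^sub>0 f
    by unfold_locales (use f in blast)+
  obtain c where c: "colouring \<theta> c" "evades_small_sets \<theta> c" using evading_colouring_of_sequence by blast
  \<comment> \<open>For \<eta> < \<beta> the value changes only where \<beta> is at most
    \<open>c \<eta> \<beta>\<close>, hence \<beta> < \<theta>; there \<eta> is below both. Evasion
    survives on restricting \<open>B\<close> to points from \<theta> on.\<close>
  define c' where "c' \<eta> \<beta> = (if c \<eta> \<beta> < \<beta> then c \<eta> \<beta> else \<eta>)" for \<eta> \<beta>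
  have "colouring \<theta> c'" using c(1) unfolding colouring_def c'_def by (fastforce simp: not_less)
  moreover have "upper_regressive c'" unfolding upper_regressive_def c'_def by auto
  moreover have "evades_small_sets \<theta> c'"
    unfolding evades_small_sets_def
  proof (intro allI impI)
    fix A B :: "'k set" and D :: "'k \<Rightarrow> 'k set" and m
    assume A: "unbounded A" and B: "unbounded B" and m: "m < \<theta>" "\<forall>\<eta>\<in>A. |D \<eta>| \<le>o |{..<m}|"
    have "unbounded (B \<inter> {\<theta>..})" unfolding unbounded_def
    proof
      fix z
      obtain b where "b \<in> B" "max z \<theta> < b" using B unfolding unbounded_def by blast
      then show "\<exists>a\<in>B \<inter> {\<theta>..}. z < a" by (intro bexI[of _ b]) auto
    qed
    with c(2) A m obtain \<eta> \<beta> where *: "\<eta> \<in> A" "\<beta> \<in> B \<inter> {\<theta>..}" "\<eta> < \<beta>" "c \<eta> \<beta> \<notin> D \<eta>"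
      unfolding evades_small_sets_def by blast
    have "c \<eta> \<beta> < \<theta>" using c(1) *(3) unfolding colouring_def by blast
    then have "c' \<eta> \<beta> = c \<eta> \<beta>" unfolding c'_def using *(2) by auto
    then have "c' \<eta> \<beta> \<notin> D \<eta>" "\<beta> \<in> B" using *(2,4) by simp_all
    then show "\<exists>\<eta>\<in>A. \<exists>\<beta>\<in>B. \<eta> < \<beta> \<and> c' \<eta> \<beta> \<notin> D \<eta>" using *(1,3) by blast
  qed
  ultimately show ?thesis by blast
qed

text \<open>Look for \<eta> in \<open>A\<close> with \<theta> positive colours on each
  \<open>B \<tau>\<close>. If none exists, completeness makes one \<tau> and one size bound
  \<open>m\<close> work on a positive subset of \<open>A\<close>, and subnormality thins it and
  \<open>B \<tau>\<close> so that only positive colours occur, contradicting evasion.\<close>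

lemma witnesses_ubd_pp_if_evades:
  fixes J :: "'k set set"
  assumes c: "colouring \<theta> c" "upper_regressive c" "evades_small_sets \<theta> c"
    and J: "ideal_over J" "subnormal J" "kappa_complete J" "bounded_ideal \<subseteq> J"
  shows "witnesses_ubd_pp c (positive J) J \<theta>"
  unfolding witnesses_ubd_pp_def
proof (intro conjI c(1,2) ballI allI impI)
  fix A and B :: "'k \<Rightarrow> 'k set"
  assume A: "A \<in> positive J" and B: "\<forall>\<tau><\<theta>. B \<tau> \<in> positive J"
  have down: "X \<in> J \<Longrightarrow> Y \<subseteq> X \<Longrightarrow> Y \<in> J" for X Y using J(1) unfolding ideal_over_def by blast
  have empty: "{} \<in> J" using J(1) unfolding ideal_over_def by blast
  have unb: "unbounded X" if X: "X \<in> positive J" for X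
    unfolding unbounded_def
  proof (rule allI, rule ccontr)
    fix z assume neg: "\<not> (\<exists>a\<in>X. z < a)"
    obtain z' where "z < z'" using no_max by blast
    then have "X \<in> bounded_ideal" using neg unfolding bounded_ideal_def by (auto simp: not_less intro: le_less_trans)
    then show False using X J(4) unfolding positive_def by blast
  qed
  have UN: "(\<Union>i\<in>I. X i) \<in> J" if I: "|I| \<le>o |{..<\<theta>}|" and X: "\<And>i. i \<in> I \<Longrightarrow> X i \<in> J"
    for I :: "'k set" and X :: "'k \<Rightarrow> 'k set"
  proof -
    have "|{..<\<theta>}| <o |UNIV :: 'k set|"
    proof (rule ccontr)
      assume "\<not> ?thesis"
      then have "|UNIV :: 'k set| \<le>o |{..<\<theta>}|" using not_ordLess_card by blast
      from bounded[OF this] show False by blast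
    qed
    then have "|X ` I| <o |UNIV :: 'k set|" using card_of_image_le[OF I] ordLeq_ordLess_trans by blast
    moreover have "X ` I \<subseteq> J" using X by blast
    ultimately show ?thesis using J(3) unfolding kappa_complete_def by blast
  qed
  define C where "C \<eta> \<tau> = {i\<in>{..<\<theta>}. {\<beta>\<in>B \<tau>. \<eta> < \<beta> \<and> c \<eta> \<beta> = i} \<notin> J}" for \<eta> \<tau>
  have "\<exists>\<eta>\<in>A. \<forall>\<tau><\<theta>. |{..<\<theta>}| \<le>o |C \<eta> \<tau>|"
  proof (rule ccontr)
    assume neg: "\<not> ?thesis"
    define A1 where "A1 \<tau> m = {\<eta>\<in>A. |C \<eta> \<tau>| \<le>o |{..<m}|}" for \<tau> m :: 'k
    have "A \<subseteq> (\<Union>\<tau>\<in>{..<\<theta>}. \<Union>m\<in>{..<\<theta>}. A1 \<tau> m)"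
    proof
      fix \<eta> assume \<eta>: "\<eta> \<in> A"
      then obtain \<tau> where \<tau>: "\<tau> < \<theta>" "\<not> |{..<\<theta>}| \<le>o |C \<eta> \<tau>|" using neg by blast
      then have "|C \<eta> \<tau>| <o |{..<\<theta>}|" using not_ordLess_card by blast
      then obtain m where "m < \<theta>" "|C \<eta> \<tau>| \<le>o |{..<m}|" using card_less_segment by blast
      then show "\<eta> \<in> (\<Union>\<tau>\<in>{..<\<theta>}. \<Union>m\<in>{..<\<theta>}. A1 \<tau> m)" unfolding A1_def using \<eta> \<tau>(1) by blast
    qed
    then have "(\<Union>\<tau>\<in>{..<\<theta>}. \<Union>m\<in>{..<\<theta>}. A1 \<tau> m) \<notin> J" using A down unfolding positive_def by blast
    moreover have "(\<Union>\<tau>\<in>{..<\<theta>}. \<Union>m\<in>{..<\<theta>}. A1 \<tau> m) \<in> J"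
      if "\<And>\<tau> m. \<tau> < \<theta> \<Longrightarrow> m < \<theta> \<Longrightarrow> A1 \<tau> m \<in> J"
      by (rule UN[OF seg_le UN[OF seg_le]]) (use that in simp)
    ultimately have "\<exists>\<tau> m. \<tau> < \<theta> \<and> m < \<theta> \<and> A1 \<tau> m \<notin> J" by blast
    then obtain \<tau> m where \<tau>: "\<tau> < \<theta>" and m: "m < \<theta>" and A1: "A1 \<tau> m \<in> positive J"
      unfolding positive_def by blast
    \<comment> \<open>For \<eta> in \<open>A1 \<tau> m\<close> the complement is covered by at most
      \<theta> fibres of colours outside \<open>C \<eta> \<tau>\<close>, each in \<open>J\<close>,
      so completeness puts \<open>E \<eta>\<close> in the dual filter; other \<eta> get the default
      \<open>UNIV\<close>.\<close>
    define E where "E \<eta> = (if \<eta> \<in> A1 \<tau> m then {\<beta>. \<beta> \<in> B \<tau> \<and> \<eta> < \<beta> \<longrightarrow> c \<eta> \<beta> \<in> C \<eta> \<tau>} else UNIV)" for \<eta>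
    have "E \<eta> \<in> dual_filter J" for \<eta>
    proof (cases "\<eta> \<in> A1 \<tau> m")
      case True
      have "(\<Union>i\<in>{..<\<theta>} - C \<eta> \<tau>. {\<beta>\<in>B \<tau>. \<eta> < \<beta> \<and> c \<eta> \<beta> = i}) \<in> J"
      proof (rule UN)
        show "|{..<\<theta>} - C \<eta> \<tau>| \<le>o |{..<\<theta>}|" by (rule card_of_mono1) blast
      qed (simp add: C_def)
      moreover have "- E \<eta> \<subseteq> (\<Union>i\<in>{..<\<theta>} - C \<eta> \<tau>. {\<beta>\<in>B \<tau>. \<eta> < \<beta> \<and> c \<eta> \<beta> = i})"
        using c(1) True unfolding E_def colouring_def by auto
      ultimately show ?thesis unfolding dual_filter_def using down by blast
    next
      case False
      then have "E \<eta> = UNIV" unfolding E_def by simp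
      then show ?thesis unfolding dual_filter_def using empty by simp
    qed
    moreover have "B \<tau> \<in> positive J" using B \<tau> by blast
    ultimately obtain A' B' where A': "A' \<in> positive J" "A' \<subseteq> A1 \<tau> m"
      and B': "B' \<in> positive J" "B' \<subseteq> B \<tau>"
      and E: "\<forall>\<eta>\<in>A'. \<forall>\<beta>\<in>B'. \<eta> < \<beta> \<longrightarrow> \<beta> \<in> E \<eta>"
      using J(2)[unfolded subnormal_def, rule_format, of E, THEN conjunct2, rule_format, OF _ A1] by blast
    have "\<forall>\<eta>\<in>A'. |C \<eta> \<tau>| \<le>o |{..<m}|" using A'(2) unfolding A1_def by blast
    then obtain \<eta> \<beta> where *: "\<eta> \<in> A'" "\<beta> \<in> B'" "\<eta> < \<beta>" "c \<eta> \<beta> \<notin> C \<eta> \<tau>"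
      using c(3)[unfolded evades_small_sets_def, rule_format, OF unb[OF A'(1)] unb[OF B'(1)] m, of "\<lambda>\<eta>. C \<eta> \<tau>"] by blast
    then have "\<beta> \<in> E \<eta>" "\<eta> \<in> A1 \<tau> m" using E A'(2) by auto
    then show False using * B'(2) unfolding E_def by auto
  qed
  then obtain \<eta> where \<eta>: "\<eta> \<in> A" "\<And>\<tau>. \<tau> < \<theta> \<Longrightarrow> |{..<\<theta>}| \<le>o |C \<eta> \<tau>|" by blast
  \<comment> \<open>Greedy choice: \<theta> colours are available at \<tau> and fewer than \<theta>
    have been used, since \<theta> is a cardinal.\<close>
  have "\<exists>h. \<forall>\<tau>. \<tau> < \<theta> \<longrightarrow> h \<tau> \<in> C \<eta> \<tau> \<and> h \<tau> \<notin> h ` {..<\<tau>}"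
  proof (rule dependent_wellorder_choice)
    fix r \<tau> :: 'k and h h' :: "'k \<Rightarrow> 'k"
    assume *: "\<And>y. y < \<tau> \<Longrightarrow> h y = h' y"
    have "h ` {..<\<tau>} = h' ` {..<\<tau>}" by (rule image_cong[OF refl]) (simp add: *)
    then show "(\<tau> < \<theta> \<longrightarrow> r \<in> C \<eta> \<tau> \<and> r \<notin> h ` {..<\<tau>}) = (\<tau> < \<theta> \<longrightarrow> r \<in> C \<eta> \<tau> \<and> r \<notin> h' ` {..<\<tau>})"
      by simp
  next
    fix \<tau> :: 'k and h :: "'k \<Rightarrow> 'k"
    show "\<exists>r. \<tau> < \<theta> \<longrightarrow> r \<in> C \<eta> \<tau> \<and> r \<notin> h ` {..<\<tau>}"
    proof (cases "\<tau> < \<theta>")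
      case True
      have "\<not> C \<eta> \<tau> \<subseteq> h ` {..<\<tau>}"
      proof
        assume "C \<eta> \<tau> \<subseteq> h ` {..<\<tau>}"
        then have "|C \<eta> \<tau>| \<le>o |{..<\<tau>}|" by (rule card_of_subset_le[OF card_of_image])
        then have "|{..<\<theta>}| \<le>o |{..<\<tau>}|" using \<eta>(2)[OF True] ordLeq_transitive by blast
        then show False using seg_less[OF True] not_ordLess_card by blast
      qed
      then show ?thesis by blast
    qed blast
  qed
  then obtain h where h: "\<And>\<tau>. \<tau> < \<theta> \<Longrightarrow> h \<tau> \<in> C \<eta> \<tau>" "\<And>\<tau>. \<tau> < \<theta> \<Longrightarrow> h \<tau> \<notin> h ` {..<\<tau>}" by blast
  have neq: "h \<sigma> \<noteq> h \<tau>" if "\<sigma> < \<tau>" "\<tau> < \<theta>" for \<sigma> \<tau>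
    using h(2)[OF that(2)] that(1) by (metis imageI lessThan_iff)
  have "inj_on h {..<\<theta>}"
    by (rule inj_onI) (metis neq lessThan_iff neq_iff)
  moreover have "h ` {..<\<theta>} \<subseteq> {..<\<theta>}" using h(1) unfolding C_def by blast
  moreover have "{\<beta>\<in>B \<tau>. \<eta> < \<beta> \<and> c \<eta> \<beta> = h \<tau>} \<in> positive J" if "\<tau> < \<theta>" for \<tau>
    using h(1)[OF that] unfolding C_def positive_def by simp
  ultimately show "\<exists>\<eta>\<in>A. \<exists>h. h ` {..<\<theta>} \<subseteq> {..<\<theta>} \<and> inj_on h {..<\<theta>} \<and>
      (\<forall>\<tau><\<theta>. {\<beta>\<in>B \<tau>. \<eta> < \<beta> \<and> c \<eta> \<beta> = h \<tau>} \<in> positive J)"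
    using \<eta>(1) by blast
qed

end

theorem theorem7p4:
  fixes \<theta> :: "'k::wellorder"
  assumes "singular_cardinal \<theta>"
    and "type_is_succ_of \<theta>"
  shows "\<exists>c :: 'k \<Rightarrow> 'k \<Rightarrow> 'k. colouring \<theta> c \<and>
    (\<forall>J :: 'k set set.
       ideal_over J \<and> subnormal J \<and> kappa_complete J \<and> bounded_ideal \<subseteq> J \<longrightarrow>
       witnesses_ubd_pp c (positive J) J \<theta>)"
proof -
  obtain K x\<^sub>0 where "singular_segment \<theta> K x\<^sub>0" using singular_segment_exists[OF assms] by blast
  then interpret singular_segment \<theta> K x\<^sub>0 .
  obtain c where "colouring \<theta> c" "upper_regressive c" "evades_small_sets \<theta> c"
    using evading_colouring by blast
  then show ?thesis using witnesses_ubd_pp_if_evades[of c] by blast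
qed

end
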